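(* Let $\widetilde{P}=\{p_i,\rho_i\}_{i=1}^m$ be an ensemble of linearly independent states on the $n$-dimensional Hilbert space $\mathcal{H}$, with $\mathrm{rank}(\rho_i)=r_i$ and $\sum_i r_i=n$. Let $p_i\rho_i=\sum_{j=1}^{r_i}|\widetilde{\psi}_{ij}\rangle\langle\widetilde{\psi}_{ij}|$ $(1\le i\le m)$ be any decomposition into unnormalized pure states, let $G$ be the $n\times n$ Gram matrix of the vectors $\{|\widetilde{\psi}_{ij}\rangle : 1\le i\le m,\ 1\le j\le r_i\}$, and let $\{|\widetilde{u}_{ij}\rangle\}$ be the dual basis, $\langle\widetilde{\psi}_{i_1j_1}|\widetilde{u}_{i_2j_2}\rangle=\delta_{i_1i_2}\delta_{j_1j_2}$. Then a POVM $\{\Pi_i\}_{i=1}^m$ is the optimal POVM for minimum error discrimination of $\widetilde{P}$ if and only if there is a block diagonal matrix $D=\mathrm{Diag}(X^{(11)},X^{(22)},\dots,X^{(mm)})$, with each $X^{(ii)}$ an $r_i\times r_i$ positive definite matrix, such that the diagonal blocks (of sizes $r_1,\dots,r_m$) of the positive square root of $DGD$ are $(X^{(11)})^2,(X^{(22)})^2,\dots,(X^{(mm)})^2$ respectively, and such that $$\Pi_i=\sum_{j=1}^{r_i}|w_{ij}\rangle\langle w_{ij}|,\qquad |w_{ij}\rangle=\sum_{l=1}^m\sum_{k=1}^{r_l}\Big(D^{-1}\sqrt{DGD}\Big)_{(lk),(ij)}|\widetilde{u}_{lk}\rangle,\qquad 1\le i\le m .$$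
   Context: Linearly independent ensemble: $p_i>0$, $\sum_i p_i=1$, the $\rho_i$ are density operators on the finite-dimensional complex Hilbert space $\mathcal{H}$, and the supports $\mathrm{supp}(\rho_1),\dots,\mathrm{supp}(\rho_m)$ are linearly independent subspaces which together span $\mathcal{H}$. All $n\times n$ matrices are indexed by pairs $(i,j)$ with $1\le i\le m$, $1\le j\le r_i$ and are partitioned into blocks of sizes $r_1,\dots,r_m$. The Gram matrix is $G_{(lk),(ij)}=\langle\widetilde{\psi}_{lk}|\widetilde{\psi}_{ij}\rangle$; it is positive definite. An $m$-element POVM is a family $\{\Pi_i\}_{i=1}^m$ with $\Pi_i\ge0$ and $\sum_i\Pi_i=\mathbb{1}$. It is optimal for minimum error discrimination (MED) of $\{p_i,\rho_i\}$ if it maximizes $P_s=\sum_i p_i\mathrm{Tr}(\rho_i\Pi_i)$ over all $m$-element POVMs; for linearly independent ensembles the optimal POVM is unique and is a projective measurement with $\mathrm{rank}(\Pi_i)=r_i$ (known fact). *)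

theory Defs
  imports "Jordan_Normal_Form.DL_Rank" "Jordan_Normal_Form.Schur_Decomposition"
    "Jordan_Normal_Form.Matrix_Kernel" "Jordan_Normal_Form.Gauss_Jordan_Elimination"
begin

text \<open>
  The Hilbert space \<open>\<H>\<close> of dimension \<open>n\<close> is \<open>\<complex>\<^sup>n\<close>, i.e. \<^term>\<open>carrier_vec n\<close> over \<^typ>\<open>complex\<close>.
  All families are indexed from \<open>0\<close>: states by \<open>i < m\<close>, the vectors of state \<open>i\<close> by \<open>j < r i\<close>.
\<close>

text \<open>Dirac's convention: conjugate-linear in the first argument
  (the library's \<open>\<bullet>c\<close> is conjugate-linear in the second).\<close>
definition braket :: "complex vec \<Rightarrow> complex vec \<Rightarrow> complex" where
  "braket v w = w \<bullet>c v"

definition ketbra :: "complex vec \<Rightarrow> complex vec \<Rightarrow> complex mat" where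
  "ketbra v w = mat (dim_vec v) (dim_vec w) (\<lambda>(a, b). v $ a * cnj (w $ b))"

abbreviation vec_sum :: "nat \<Rightarrow> ('i \<Rightarrow> complex vec) \<Rightarrow> 'i set \<Rightarrow> complex vec" where
  "vec_sum n \<equiv> finsum_vec TYPE(complex) n"

abbreviation mat_sum :: "nat \<Rightarrow> ('i \<Rightarrow> complex mat) \<Rightarrow> 'i set \<Rightarrow> complex mat" where
  "mat_sum n \<equiv> finsum (module_mat TYPE(complex) n n)"

definition mat_trace :: "complex mat \<Rightarrow> complex" where
  "mat_trace A = (\<Sum>a<dim_row A. A $$ (a, a))"

definition hermitian_mat :: "nat \<Rightarrow> complex mat \<Rightarrow> bool" where
  "hermitian_mat n A \<longleftrightarrow> A \<in> carrier_mat n n \<and> mat_adjoint A = A"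

text \<open>For Hermitian \<open>A\<close> the value \<open>\<langle>v|A|v\<rangle>\<close> is real, so taking \<^const>\<open>Re\<close> loses nothing.\<close>
definition psd_mat :: "nat \<Rightarrow> complex mat \<Rightarrow> bool" where
  "psd_mat n A \<longleftrightarrow> hermitian_mat n A \<and> (\<forall>v \<in> carrier_vec n. 0 \<le> Re (braket v (A *\<^sub>v v)))"

definition pd_mat :: "nat \<Rightarrow> complex mat \<Rightarrow> bool" where
  "pd_mat n A \<longleftrightarrow> hermitian_mat n A \<and>
     (\<forall>v \<in> carrier_vec n. v \<noteq> 0\<^sub>v n \<longrightarrow> 0 < Re (braket v (A *\<^sub>v v)))"

text \<open>The positive square root; meaningful for positive semidefinite \<open>A\<close>, where it is unique.\<close>
definition mat_sqrt :: "complex mat \<Rightarrow> complex mat" where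
  "mat_sqrt A = (THE S. psd_mat (dim_row A) S \<and> S * S = A)"

text \<open>Meaningful for invertible \<open>A\<close> only.\<close>
definition mat_inv :: "complex mat \<Rightarrow> complex mat" where
  "mat_inv A = the (mat_inverse A)"

subsection \<open>Linearly independent ensembles\<close>

definition density_operator :: "nat \<Rightarrow> complex mat \<Rightarrow> bool" where
  "density_operator n A \<longleftrightarrow> psd_mat n A \<and> mat_trace A = 1"

text \<open>The support of an operator on \<open>\<complex>\<^sup>n\<close> is the orthogonal complement of its kernel.\<close>
definition mat_support :: "nat \<Rightarrow> complex mat \<Rightarrow> complex vec set" where
  "mat_support n A = {v \<in> carrier_vec n. \<forall>w \<in> mat_kernel A. braket w v = 0}"

definition lin_indep_subspaces :: "nat \<Rightarrow> nat \<Rightarrow> (nat \<Rightarrow> complex vec set) \<Rightarrow> bool" where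
  "lin_indep_subspaces n m V \<longleftrightarrow>
     (\<forall>v. (\<forall>i<m. v i \<in> V i) \<and> vec_sum n v {..<m} = 0\<^sub>v n \<longrightarrow> (\<forall>i<m. v i = 0\<^sub>v n))"

definition spanning_subspaces :: "nat \<Rightarrow> nat \<Rightarrow> (nat \<Rightarrow> complex vec set) \<Rightarrow> bool" where
  "spanning_subspaces n m V \<longleftrightarrow>
     (\<forall>x \<in> carrier_vec n. \<exists>v. (\<forall>i<m. v i \<in> V i) \<and> x = vec_sum n v {..<m})"

definition lin_indep_ensemble ::
  "nat \<Rightarrow> nat \<Rightarrow> (nat \<Rightarrow> real) \<Rightarrow> (nat \<Rightarrow> complex mat) \<Rightarrow> bool" where
  "lin_indep_ensemble n m p \<rho> \<longleftrightarrow>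
     (\<forall>i<m. 0 < p i) \<and> (\<Sum>i<m. p i) = 1 \<and> (\<forall>i<m. density_operator n (\<rho> i)) \<and>
     lin_indep_subspaces n m (\<lambda>i. mat_support n (\<rho> i)) \<and>
     spanning_subspaces n m (\<lambda>i. mat_support n (\<rho> i))"

subsection \<open>Minimum error discrimination\<close>

definition is_povm :: "nat \<Rightarrow> nat \<Rightarrow> (nat \<Rightarrow> complex mat) \<Rightarrow> bool" where
  "is_povm n m E \<longleftrightarrow> (\<forall>i<m. psd_mat n (E i)) \<and> mat_sum n E {..<m} = 1\<^sub>m n"

text \<open>The traces below are real when \<open>\<rho> i\<close> and \<open>E i\<close> are Hermitian.\<close>
definition success_prob ::
  "nat \<Rightarrow> (nat \<Rightarrow> real) \<Rightarrow> (nat \<Rightarrow> complex mat) \<Rightarrow> (nat \<Rightarrow> complex mat) \<Rightarrow> real" where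
  "success_prob m p \<rho> E = (\<Sum>i<m. p i * Re (mat_trace (\<rho> i * E i)))"

definition med_optimal ::
  "nat \<Rightarrow> nat \<Rightarrow> (nat \<Rightarrow> real) \<Rightarrow> (nat \<Rightarrow> complex mat) \<Rightarrow> (nat \<Rightarrow> complex mat) \<Rightarrow> bool" where
  "med_optimal n m p \<rho> E \<longleftrightarrow> is_povm n m E \<and>
     (\<forall>E'. is_povm n m E' \<longrightarrow> success_prob m p \<rho> E' \<le> success_prob m p \<rho> E)"

subsection \<open>Matrices indexed by pairs\<close>

text \<open>
  A matrix indexed by the pairs \<open>(i, j)\<close> with \<open>i < m\<close>, \<open>j < r i\<close> is a matrix of size
  \<open>\<Sum>i<m. r i\<close> whose rows and columns list the pairs lexicographically, so that its blocks are
  contiguous; \<open>pair_index r (i, j)\<close> is the position of \<open>(i, j)\<close>.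
\<close>
definition pairs :: "nat \<Rightarrow> (nat \<Rightarrow> nat) \<Rightarrow> (nat \<times> nat) list" where
  "pairs m r = concat (map (\<lambda>i. map (Pair i) [0..<r i]) [0..<m])"

definition pair_index :: "(nat \<Rightarrow> nat) \<Rightarrow> nat \<times> nat \<Rightarrow> nat" where
  "pair_index r = (\<lambda>(i, j). (\<Sum>l<i. r l) + j)"

lemma length_pairs: "length (pairs m r) = (\<Sum>i<m. r i)"
  by (induction m) (auto simp: pairs_def)

lemma pairs_nth_pair_index:
  assumes "i < m" "j < r i"
  shows "pair_index r (i, j) < length (pairs m r)" "pairs m r ! pair_index r (i, j) = (i, j)"
proof -
  have "pair_index r (i, j) < length (pairs m r) \<and> pairs m r ! pair_index r (i, j) = (i, j)"
    using assms(1)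
  proof (induction m)
    case (Suc m)
    have *: "pairs (Suc m) r = pairs m r @ map (Pair m) [0..<r m]"
      by (simp add: pairs_def)
    show ?case
    proof (cases "i = m")
      case True
      then show ?thesis
        using assms(2) unfolding * by (simp add: pair_index_def nth_append length_pairs)
    next
      case False
      then show ?thesis
        using Suc unfolding * by (auto simp: nth_append)
    qed
  qed simp
  then show "pair_index r (i, j) < length (pairs m r)"
    "pairs m r ! pair_index r (i, j) = (i, j)" by auto
qed

definition pair_mat :: "nat \<Rightarrow> (nat \<Rightarrow> nat) \<Rightarrow> (nat \<times> nat \<Rightarrow> nat \<times> nat \<Rightarrow> complex) \<Rightarrow> complex mat" where
  "pair_mat m r f = mat (length (pairs m r)) (length (pairs m r))
     (\<lambda>(a, b). f (pairs m r ! a) (pairs m r ! b))"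

definition pair_entry :: "(nat \<Rightarrow> nat) \<Rightarrow> complex mat \<Rightarrow> nat \<times> nat \<Rightarrow> nat \<times> nat \<Rightarrow> complex" where
  "pair_entry r A s t = A $$ (pair_index r s, pair_index r t)"

definition diag_block :: "(nat \<Rightarrow> nat) \<Rightarrow> complex mat \<Rightarrow> nat \<Rightarrow> complex mat" where
  "diag_block r A i = mat (r i) (r i) (\<lambda>(j, k). pair_entry r A (i, j) (i, k))"

definition gram_mat :: "nat \<Rightarrow> (nat \<Rightarrow> nat) \<Rightarrow> (nat \<Rightarrow> nat \<Rightarrow> complex vec) \<Rightarrow> complex mat" where
  "gram_mat m r \<psi> = pair_mat m r (\<lambda>(l, k) (i, j). braket (\<psi> l k) (\<psi> i j))"

end

theory Submission
  imports Defs "Jordan_Normal_Form.Spectral_Radius"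
begin

text \<open>
  A measurement is optimal iff some operator \<open>K\<close> satisfies \<open>K \<ge> p\<^sub>i\<rho>\<^sub>i\<close> and \<open>K E\<^sub>i = p\<^sub>i\<rho>\<^sub>i E\<^sub>i\<close> for all \<open>i\<close>.
  Put the \<open>\<psi>\<^sub>i\<^sub>j\<close> into the columns of an invertible matrix \<open>\<Psi>\<close>, let \<open>P\<^sub>i\<close> project onto the \<open>i\<close>-th block, so
  that \<open>p\<^sub>i\<rho>\<^sub>i = \<Psi> P\<^sub>i \<Psi>\<^sup>\<dagger>\<close>, and let \<open>U = (\<Psi>\<^sup>\<dagger>)\<^bsup>-1\<^esup>\<close> be the dual basis.
  Given \<open>D\<close> and \<open>S = \<surd>(D G D)\<close>, the matrix \<open>W = U D\<^bsup>-1\<^esup> S\<close> is unitary and \<open>K = W S W\<^sup>\<dagger>\<close> satisfies the criterion: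
  the block condition on \<open>S\<close> gives the equations, and the inequalities are those between a
  positive matrix and its Schur complements.
  Conversely, given \<open>K\<close>, the equations make \<open>U\<^sup>\<dagger> K\<^sup>2 U\<close> commute with every \<open>P\<^sub>i\<close>; its positive square root is \<open>D\<close>,
  and \<open>W = K\<^bsup>-1\<^esup> \<Psi> D\<close> is a unitary which turns \<open>P\<^sub>i\<close> into \<open>E\<^sub>i\<close> and \<open>K\<close> into \<open>S\<close>.
\<close>

subsection \<open>Matrix algebra\<close>

text \<open>Both directions read off one polar decomposition: \<open>\<Psi> D = W S = K W\<close>,
  where \<open>S\<^sup>2 = D G D\<close> and \<open>K = W S W\<^sup>\<dagger>\<close>. The form with
  \<open>K\<close> on the left explains the choice of \<open>D\<close>, since it forces
  \<open>K\<^sup>2 = \<Psi> D\<^sup>2 \<Psi>\<^sup>\<dagger>\<close>, that is,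
  \<open>D\<^sup>2 = U\<^sup>\<dagger> K\<^sup>2 U\<close>. The point to be shown is that this
  matrix is block diagonal. Inserting \<open>\<Sum> E\<^sub>i = 1\<close> between the two factors
  \<open>K\<close> splits it into the Hermitian summands
  \<open>U\<^sup>\<dagger> K E\<^sub>i K U\<close>. By \<open>K E\<^sub>i = \<Psi> P\<^sub>i
  \<Psi>\<^sup>\<dagger> E\<^sub>i\<close> and \<open>U\<^sup>\<dagger> \<Psi> = 1\<close> the
  summand \<open>i\<close> has nonzero rows in block \<open>i\<close> only, and being Hermitian it
  has nonzero columns there only. Since \<open>D\<close> occurs inside the root whose blocks it
  prescribes, the condition on \<open>D\<close> is a fixed-point equation. It is never solved: a
  solution is obtained from the \<open>K\<close> of an optimal measurement, and conversely every
  solution yields such a \<open>K\<close>.\<close>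

notation mat_adjoint ("_\<^sup>\<dagger>" [1000] 999)

lemma dim_mat_adjoint [simp]: "dim_row (A\<^sup>\<dagger>) = dim_col A" "dim_col (A\<^sup>\<dagger>) = dim_row A"
  by (auto simp: mat_adjoint_def)

lemma mat_adjoint_index [simp]:
  "i < dim_col A \<Longrightarrow> j < dim_row A \<Longrightarrow> (A\<^sup>\<dagger>) $$ (i, j) = conjugate (A $$ (j, i))"
  by (simp add: mat_adjoint_def mat_of_rows_index)

lemma mat_adjoint_carrier [simp]: "A \<in> carrier_mat n k \<Longrightarrow> A\<^sup>\<dagger> \<in> carrier_mat k n"
  by (auto intro!: carrier_matI)

lemma mat_adjoint_adjoint [simp]: "(A\<^sup>\<dagger>)\<^sup>\<dagger> = A"
  by (intro eq_matI) auto

lemma mat_mult_index_sum: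
  "i < dim_row A \<Longrightarrow> j < dim_col B \<Longrightarrow> dim_col A = dim_row B \<Longrightarrow>
    (A * B) $$ (i, j) = (\<Sum>k<dim_row B. A $$ (i, k) * B $$ (k, j))"
  by (auto simp: scalar_prod_def atLeast0LessThan)

lemma mat_adjoint_mult:
  fixes A B :: "complex mat"
  assumes "dim_col A = dim_row B"
  shows "(A * B)\<^sup>\<dagger> = B\<^sup>\<dagger> * A\<^sup>\<dagger>"
  using assms
  by (intro eq_matI) (auto simp: mat_mult_index_sum simp del: index_mult_mat(1) intro!: sum.cong)

lemma mat_adjoint_add:
  fixes A B :: "complex mat"
  assumes "dim_row A = dim_row B" "dim_col A = dim_col B"
  shows "(A + B)\<^sup>\<dagger> = A\<^sup>\<dagger> + B\<^sup>\<dagger>"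
  using assms by (intro eq_matI) auto

lemma mat_adjoint_diff:
  fixes A B :: "complex mat"
  assumes "dim_row A = dim_row B" "dim_col A = dim_col B"
  shows "(A - B)\<^sup>\<dagger> = A\<^sup>\<dagger> - B\<^sup>\<dagger>"
  using assms by (intro eq_matI) auto

lemma mat_adjoint_smult: "(c \<cdot>\<^sub>m A)\<^sup>\<dagger> = cnj c \<cdot>\<^sub>m A\<^sup>\<dagger>"
  by (intro eq_matI) auto

lemma mat_adjoint_one [simp]: "(1\<^sub>m n :: complex mat)\<^sup>\<dagger> = 1\<^sub>m n"
  by (intro eq_matI) auto

lemma mat_assoc_dim:
  fixes A B C :: "complex mat"
  shows "dim_col A = dim_row B \<Longrightarrow> dim_col B = dim_row C \<Longrightarrow> A * B * C = A * (B * C)"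
  by (rule assoc_mult_mat[of _ "dim_row A" "dim_col A" _ "dim_col B" _ "dim_col C"]) auto

text \<open>Lets an equation between products be used in the middle of a right-nested product.\<close>
lemma mat_assoc_cong:
  fixes A B C :: "complex mat"
  assumes "A * B = C" "dim_col A = dim_row B" "dim_col B = dim_row Z"
  shows "A * (B * Z) = C * Z"
  using assms mat_assoc_dim[of A B Z] by simp

lemma mat_distrib_dim:
  fixes A B C :: "complex mat"
  shows "dim_row A = dim_row B \<Longrightarrow> dim_col A = dim_col B \<Longrightarrow> dim_col A = dim_row C \<Longrightarrow>
      (A + B) * C = A * C + B * C"
    "dim_row B = dim_row C \<Longrightarrow> dim_col B = dim_col C \<Longrightarrow> dim_col A = dim_row B \<Longrightarrow>
      A * (B + C) = A * B + A * C"
    "dim_row A = dim_row B \<Longrightarrow> dim_col A = dim_col B \<Longrightarrow> dim_col A = dim_row C \<Longrightarrow>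
      (A - B) * C = A * C - B * C"
    "dim_row B = dim_row C \<Longrightarrow> dim_col B = dim_col C \<Longrightarrow> dim_col A = dim_row B \<Longrightarrow>
      A * (B - C) = A * B - A * C"
  subgoal by (rule add_mult_distrib_mat) auto
  subgoal by (rule mult_add_distrib_mat) auto
  subgoal by (rule minus_mult_distrib_mat) auto
  subgoal by (rule mult_minus_distrib_mat) auto
  done

lemma mat_smult_dim:
  fixes A B :: "complex mat"
  shows "dim_col A = dim_row B \<Longrightarrow> (c \<cdot>\<^sub>m A) * B = c \<cdot>\<^sub>m (A * B)"
    "dim_col A = dim_row B \<Longrightarrow> A * (c \<cdot>\<^sub>m B) = c \<cdot>\<^sub>m (A * B)"
  subgoal by (rule mult_smult_assoc_mat) auto
  subgoal by (rule mult_smult_distrib) auto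
  done

lemma mat_assoc_vec_dim:
  fixes A B :: "complex mat"
  shows "dim_col A = dim_row B \<Longrightarrow> dim_col B = dim_vec v \<Longrightarrow> A * B *\<^sub>v v = A *\<^sub>v (B *\<^sub>v v)"
  by (rule assoc_mult_mat_vec[of _ "dim_row A" "dim_col A" _ "dim_col B"]) auto

lemma mat_diff_eq_0:
  fixes A B :: "complex mat"
  assumes "A - B = 0\<^sub>m (dim_row B) (dim_col B)" "dim_row A = dim_row B" "dim_col A = dim_col B"
  shows "A = B"
proof (rule eq_matI)
  fix i j assume "i < dim_row B" "j < dim_col B"
  thus "A $$ (i, j) = B $$ (i, j)"
    using arg_cong[OF assms(1), of "\<lambda>M. M $$ (i, j)"] by simp
qed (use assms in auto)

lemma mat_mult_zero_vec: "dim_col A = n \<Longrightarrow> A *\<^sub>v 0\<^sub>v n = 0\<^sub>v (dim_row A)"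
  by (intro eq_vecI) auto

subsection \<open>Traces\<close>

lemma mat_trace_mult_commute:
  "dim_col A = dim_row B \<Longrightarrow> dim_col B = dim_row A \<Longrightarrow> mat_trace (A * B) = mat_trace (B * A)"
  unfolding mat_trace_def
  by (simp add: mat_mult_index_sum del: index_mult_mat(1), subst sum.swap)
    (simp add: mult.commute)

lemma mat_trace_add:
  "dim_row A = dim_row B \<Longrightarrow> dim_col A = dim_row A \<Longrightarrow> dim_col B = dim_row B \<Longrightarrow>
    mat_trace (A + B) = mat_trace A + mat_trace B"
  unfolding mat_trace_def by (simp add: sum.distrib)

lemma mat_trace_diff:
  "dim_row A = dim_row B \<Longrightarrow> dim_col A = dim_row A \<Longrightarrow> dim_col B = dim_row B \<Longrightarrow>
    mat_trace (A - B) = mat_trace A - mat_trace B"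
  unfolding mat_trace_def by (simp add: sum_subtractf)

lemma mat_trace_smult: "dim_col A = dim_row A \<Longrightarrow> mat_trace (c \<cdot>\<^sub>m A) = c * mat_trace A"
  unfolding mat_trace_def by (simp add: sum_distrib_left)

lemma mat_trace_adjoint: "dim_col A = dim_row A \<Longrightarrow> mat_trace (A\<^sup>\<dagger>) = cnj (mat_trace A)"
  unfolding mat_trace_def by simp

lemma complex_cnj_mult_self: "cnj z * z = (complex_of_real (cmod z))\<^sup>2"
  by (simp add: complex_norm_square mult.commute flip: of_real_power)

text \<open>This is the squared Frobenius norm, through which a vanishing trace becomes a vanishing
  matrix.\<close>

lemma mat_trace_adjoint_mult_self:
  "mat_trace (A\<^sup>\<dagger> * A) = of_real (\<Sum>i<dim_col A. \<Sum>k<dim_row A. (cmod (A $$ (k, i)))\<^sup>2)"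
  unfolding mat_trace_def
  by (simp add: mat_mult_index_sum complex_cnj_mult_self del: index_mult_mat(1))

lemma mat_adjoint_mult_self_eq_0:
  assumes "Re (mat_trace (A\<^sup>\<dagger> * A)) = 0"
  shows "A = 0\<^sub>m (dim_row A) (dim_col A)"
proof -
  have "(\<Sum>i<dim_col A. \<Sum>k<dim_row A. (cmod (A $$ (k, i)))\<^sup>2) = 0"
    using assms unfolding mat_trace_adjoint_mult_self by simp
  hence "\<forall>i<dim_col A. \<forall>k<dim_row A. A $$ (k, i) = 0"
    by (subst (asm) sum_nonneg_eq_0_iff, simp_all add: sum_nonneg)
      (subst (asm) sum_nonneg_eq_0_iff, auto)
  thus ?thesis by (intro eq_matI) auto
qed

subsection \<open>The quadratic form\<close>

lemma braket_sum: "dim_vec w = dim_vec v \<Longrightarrow> braket v w = (\<Sum>i<dim_vec v. cnj (v $ i) * w $ i)"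
  unfolding braket_def by (auto simp: scalar_prod_def atLeast0LessThan mult.commute)

lemma braket_mult_mat:
  assumes "dim_row A = dim_vec v" "dim_col A = dim_vec w"
  shows "braket v (A *\<^sub>v w) = braket (A\<^sup>\<dagger> *\<^sub>v v) w"
  using assms
  by (simp add: braket_sum scalar_prod_def atLeast0LessThan sum_distrib_left sum_distrib_right,
      subst sum.swap) (auto intro!: sum.cong)

lemma braket_add_mat:
  assumes "dim_row A = dim_vec v" "dim_col A = dim_vec v" "dim_row B = dim_vec v" "dim_col B = dim_vec v"
  shows "braket v ((A + B) *\<^sub>v v) = braket v (A *\<^sub>v v) + braket v (B *\<^sub>v v)"
  using assms
  by (simp add: braket_sum scalar_prod_def sum.distrib algebra_simps)

lemma braket_diff_mat:
  assumes "dim_row A = dim_vec v" "dim_col A = dim_vec v" "dim_row B = dim_vec v" "dim_col B = dim_vec v"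
  shows "braket v ((A - B) *\<^sub>v v) = braket v (A *\<^sub>v v) - braket v (B *\<^sub>v v)"
  using assms
  by (simp add: braket_sum scalar_prod_def sum_subtractf algebra_simps)

lemma braket_smult_mat:
  assumes "dim_row A = dim_vec v" "dim_col A = dim_vec v"
  shows "braket v ((c \<cdot>\<^sub>m A) *\<^sub>v v) = c * braket v (A *\<^sub>v v)"
  using assms
  by (simp add: braket_sum scalar_prod_def sum_distrib_left algebra_simps)

lemma braket_adjoint_mat:
  assumes "dim_row A = dim_vec v" "dim_col A = dim_vec v"
  shows "braket v (A\<^sup>\<dagger> *\<^sub>v v) = cnj (braket v (A *\<^sub>v v))"
  using assms
  by (simp add: braket_sum scalar_prod_def sum_distrib_left, subst sum.swap)
    (simp add: atLeast0LessThan algebra_simps)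

lemma braket_self: "braket v v = of_real (\<Sum>i<dim_vec v. (cmod (v $ i))\<^sup>2)"
  by (simp add: braket_sum complex_cnj_mult_self)

lemma braket_self_nonneg [simp]: "0 \<le> Re (braket v v)"
  by (simp add: braket_self sum_nonneg)

lemma braket_self_eq_0: "Re (braket v v) = 0 \<Longrightarrow> v = 0\<^sub>v (dim_vec v)"
  unfolding braket_self by (intro eq_vecI) (auto simp: sum_nonneg_eq_0_iff)

lemma braket_self_pos: "v \<in> carrier_vec n \<Longrightarrow> v \<noteq> 0\<^sub>v n \<Longrightarrow> 0 < Re (braket v v)"
  using braket_self_eq_0[of v] braket_self_nonneg[of v] by (auto simp: less_le)

lemma mat_trace_mult_ketbra:
  assumes "dim_row A = dim_vec v" "dim_col A = dim_vec v"
  shows "mat_trace (A * ketbra v v) = braket v (A *\<^sub>v v)"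
  using assms unfolding mat_trace_def
  by (simp add: braket_sum mat_mult_index_sum ketbra_def scalar_prod_def sum_distrib_left
      atLeast0LessThan del: index_mult_mat(1)) (simp add: algebra_simps)

subsection \<open>Positive matrices\<close>

lemma psd_matD:
  assumes "psd_mat n A"
  shows "A \<in> carrier_mat n n" "dim_row A = n" "dim_col A = n" "A\<^sup>\<dagger> = A"
    "v \<in> carrier_vec n \<Longrightarrow> 0 \<le> Re (braket v (A *\<^sub>v v))"
  using assms by (auto simp: psd_mat_def hermitian_mat_def)

lemma pd_matD:
  assumes "pd_mat n A"
  shows "A \<in> carrier_mat n n" "dim_row A = n" "dim_col A = n" "A\<^sup>\<dagger> = A"
    "v \<in> carrier_vec n \<Longrightarrow> v \<noteq> 0\<^sub>v n \<Longrightarrow> 0 < Re (braket v (A *\<^sub>v v))"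
  using assms by (auto simp: pd_mat_def hermitian_mat_def)

text \<open>At \<open>v\<close> the form of the product is the form of \<open>A\<close> at
  \<open>C *\<^sub>v v\<close>. This is the source of positivity for the perturbed measurements, for
  the root \<open>S\<close> and for the Schur complements below.\<close>

lemma psd_mat_congruence:
  assumes A: "psd_mat k A" and C: "C \<in> carrier_mat k n"
  shows "psd_mat n (C\<^sup>\<dagger> * A * C)"
proof -
  note [simp] = psd_matD(2-4)[OF A]
  have [simp]: "dim_row C = k" "dim_col C = n" using C by auto
  have "0 \<le> Re (braket v (C\<^sup>\<dagger> * A * C *\<^sub>v v))" if v: "v \<in> carrier_vec n" for v
  proof -
    have "braket v (C\<^sup>\<dagger> * A * C *\<^sub>v v) = braket (C *\<^sub>v v) (A *\<^sub>v (C *\<^sub>v v))"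
      using v by (simp add: mat_assoc_vec_dim braket_mult_mat[of "C\<^sup>\<dagger>"])
    thus ?thesis using psd_matD(5)[OF A, of "C *\<^sub>v v"] mult_mat_vec_carrier[OF C v] by simp
  qed
  thus ?thesis
    by (auto simp: psd_mat_def hermitian_mat_def mat_adjoint_mult mat_assoc_dim intro!: carrier_matI)
qed

lemma psd_mat_one: "psd_mat n (1\<^sub>m n)"
  by (auto simp: psd_mat_def hermitian_mat_def)

lemma psd_mat_zero: "psd_mat n (0\<^sub>m n n)"
proof -
  have "(0\<^sub>m n n)\<^sup>\<dagger> * 1\<^sub>m n * 0\<^sub>m n n = (0\<^sub>m n n :: complex mat)" by (intro eq_matI) auto
  thus ?thesis using psd_mat_congruence[OF psd_mat_one zero_carrier_mat] by metis
qed

lemma psd_mat_adjoint_mult_self: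
  assumes "C \<in> carrier_mat k n"
  shows "psd_mat n (C\<^sup>\<dagger> * C)"
proof -
  have "C\<^sup>\<dagger> * 1\<^sub>m k * C = C\<^sup>\<dagger> * C"
    using assms by (metis mat_adjoint_carrier right_mult_one_mat)
  thus ?thesis using psd_mat_congruence[OF psd_mat_one assms] by simp
qed

lemma psd_mat_add:
  assumes "psd_mat n A" "psd_mat n B"
  shows "psd_mat n (A + B)"
  using psd_matD[OF assms(1)] psd_matD[OF assms(2)]
  by (auto simp: psd_mat_def hermitian_mat_def mat_adjoint_add braket_add_mat)

lemma psd_mat_smult:
  assumes "psd_mat n A" "0 \<le> c"
  shows "psd_mat n (complex_of_real c \<cdot>\<^sub>m A)"
  using psd_matD[OF assms(1)] assms(2)
  by (auto simp: psd_mat_def hermitian_mat_def mat_adjoint_smult braket_smult_mat)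

lemma pd_mat_imp_psd_mat:
  assumes "pd_mat n A"
  shows "psd_mat n A"
proof -
  have "0 \<le> Re (braket v (A *\<^sub>v v))" if "v \<in> carrier_vec n" for v
    using pd_matD(1)[OF assms] pd_matD(5)[OF assms that] that
    by (cases "v = 0\<^sub>v n") (auto simp: braket_sum)
  thus ?thesis using assms by (auto simp: pd_mat_def psd_mat_def)
qed

lemma mat_left_inverse_imp_right_inverse:
  fixes A B :: "complex mat"
  assumes "A * B = 1\<^sub>m n" "dim_row A = n" "dim_col A = n" "dim_row B = n" "dim_col B = n"
  shows "B * A = 1\<^sub>m n"
  using mat_mult_left_right_inverse[of A n B] assms by (auto intro: carrier_matI)

text \<open>A trivial kernel means a nonzero determinant, so \<open>A\<close> is a unit of the
  matrix ring and \<open>mat_inverse\<close> returns \<open>Some\<close>; this is what gives the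
  \<open>the\<close> in \<open>mat_inv\<close> a meaning.\<close>

lemma mat_inv_inverse:
  fixes A :: "complex mat"
  assumes A: "A \<in> carrier_mat n n"
    and ker: "\<And>v. v \<in> carrier_vec n \<Longrightarrow> A *\<^sub>v v = 0\<^sub>v n \<Longrightarrow> v = 0\<^sub>v n"
  shows "mat_inv A \<in> carrier_mat n n" "A * mat_inv A = 1\<^sub>m n" "mat_inv A * A = 1\<^sub>m n"
proof -
  have "det A \<noteq> 0" using ker det_0_iff_vec_prod_zero_field[OF A] by auto
  hence "A \<in> Units (ring_mat TYPE(complex) n ())" using det_non_zero_imp_unit[OF A] by auto
  then obtain B where "mat_inverse A = Some B" using mat_inverse(1)[OF A, of "()"] by (cases "mat_inverse A") auto
  with mat_inverse(2)[OF A this]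
  show "mat_inv A \<in> carrier_mat n n" "A * mat_inv A = 1\<^sub>m n" "mat_inv A * A = 1\<^sub>m n"
    by (auto simp: mat_inv_def)
qed

lemma pd_mat_kernel:
  assumes "pd_mat n A" "v \<in> carrier_vec n" "A *\<^sub>v v = 0\<^sub>v n"
  shows "v = 0\<^sub>v n"
  using pd_matD(5)[OF assms(1,2)] assms(2,3) by (auto simp: braket_sum)

subsection \<open>The spectral theorem and positive square roots\<close>

text \<open>The entries are kept as reals because eigenvalues of Hermitian matrices are real: the
  matrix is then its own adjoint, and roots are taken entrywise with the real
  \<open>sqrt\<close>.\<close>

definition real_diag :: "nat \<Rightarrow> (nat \<Rightarrow> real) \<Rightarrow> complex mat" where
  "real_diag n d = mat n n (\<lambda>(i, j). if i = j then of_real (d i) else 0)"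

lemma real_diag_simps [simp]:
  "dim_row (real_diag n d) = n" "dim_col (real_diag n d) = n"
  "i < n \<Longrightarrow> j < n \<Longrightarrow> real_diag n d $$ (i, j) = (if i = j then of_real (d i) else 0)"
  "(real_diag n d)\<^sup>\<dagger> = real_diag n d"
  by (auto simp: real_diag_def intro!: eq_matI)

lemma real_diag_mult: "real_diag n d * real_diag n e = real_diag n (\<lambda>i. d i * e i)"
proof (rule eq_matI)
  fix i j assume "i < dim_row (real_diag n (\<lambda>i. d i * e i))" "j < dim_col (real_diag n (\<lambda>i. d i * e i))"
  hence ij: "i < n" "j < n" by auto
  have "(real_diag n d * real_diag n e) $$ (i, j) =
      (\<Sum>k<n. if k = i then (if i = j then of_real (d i * e i) else 0) else 0)"
    using ij by (subst mat_mult_index_sum) (auto simp del: sum.delta sum.delta' intro!: sum.cong)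
  thus "(real_diag n d * real_diag n e) $$ (i, j) = real_diag n (\<lambda>i. d i * e i) $$ (i, j)"
    using ij by simp
qed auto

section \<open>Unitary matrices and diagonalisation\<close>

definition unitary_mat :: "nat \<Rightarrow> complex mat \<Rightarrow> bool" where
  "unitary_mat n Q \<longleftrightarrow> Q \<in> carrier_mat n n \<and> Q\<^sup>\<dagger> * Q = 1\<^sub>m n \<and> Q * Q\<^sup>\<dagger> = 1\<^sub>m n"

lemma unitary_matD:
  assumes "unitary_mat n Q"
  shows "Q \<in> carrier_mat n n" "dim_row Q = n" "dim_col Q = n"
    "Q\<^sup>\<dagger> * Q = 1\<^sub>m n" "Q * Q\<^sup>\<dagger> = 1\<^sub>m n"
    "dim_row Z = n \<Longrightarrow> Q\<^sup>\<dagger> * (Q * Z) = Z" "dim_row Z = n \<Longrightarrow> Q * (Q\<^sup>\<dagger> * Z) = Z"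
proof -
  show *: "Q \<in> carrier_mat n n" "Q\<^sup>\<dagger> * Q = 1\<^sub>m n" "Q * Q\<^sup>\<dagger> = 1\<^sub>m n"
    using assms by (auto simp: unitary_mat_def)
  thus "dim_row Q = n" "dim_col Q = n" by auto
  thus "Q\<^sup>\<dagger> * (Q * Z) = Z" "Q * (Q\<^sup>\<dagger> * Z) = Z" if "dim_row Z = n"
    using mat_assoc_cong[OF *(2), of Z] mat_assoc_cong[OF *(3), of Z] that by auto
qed

lemma unitary_matI:
  assumes "Q \<in> carrier_mat n n" "Q\<^sup>\<dagger> * Q = 1\<^sub>m n"
  shows "unitary_mat n Q"
proof -
  have "dim_row Q = n" "dim_col Q = n" using assms by auto
  thus ?thesis using assms mat_left_inverse_imp_right_inverse[OF assms(2)]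
    by (simp add: unitary_mat_def)
qed

lemma unitary_mat_mult:
  assumes "unitary_mat n Q" "unitary_mat n V"
  shows "unitary_mat n (Q * V)"
proof (rule unitary_matI)
  note [simp] = unitary_matD[OF assms(1)] unitary_matD[OF assms(2)]
  show "Q * V \<in> carrier_mat n n" by (intro carrier_matI) auto
  show "(Q * V)\<^sup>\<dagger> * (Q * V) = 1\<^sub>m n"
    by (simp add: mat_adjoint_mult mat_assoc_dim)
qed

lemma adjoint_mult_index:
  fixes A B :: "complex mat"
  assumes "dim_row A = dim_row B" "i < dim_col A" "j < dim_col B"
  shows "(A\<^sup>\<dagger> * B) $$ (i, j) = braket (col A i) (col B j)"
  using assms by (simp add: mat_mult_index_sum braket_sum del: index_mult_mat(1))

text \<open>\<open>v\<close> is completed to a basis and orthogonalised by Gram-Schmidt, which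
  leaves the first vector alone; scaling all columns to length one gives a unitary matrix. The
  factor \<open>c\<close> is the reciprocal of the length of \<open>v\<close>.\<close>

lemma unitary_completion:
  assumes v: "v \<in> carrier_vec n" "v \<noteq> 0\<^sub>v n"
  obtains Q c where "unitary_mat n Q" "c \<noteq> 0" "col Q 0 = c \<cdot>\<^sub>v v"
proof -
  have n: "n > 0" using v by (cases n) auto
  define b where "b = basis_completion v"
  define ws where "ws = gram_schmidt n b"
  define W where "W = mat_of_cols n ws"
  interpret cof_vec_space n "TYPE(complex)" .
  from basis_completion[OF v, folded b_def]
  have dist_b: "distinct b" and indep: "\<not> lin_dep (set b)" and b: "set b \<subseteq> carrier_vec n"
    and hdb: "hd b = v" and len_b: "length b = n" by auto
  from hdb len_b n obtain vs where bv: "b = v # vs" by (cases b) auto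
  from gram_schmidt_result[OF b dist_b indep refl, folded ws_def]
  have ws: "set ws \<subseteq> carrier_vec n" "corthogonal ws" "length ws = n" by (auto simp: len_b)
  from gram_schmidt_hd[OF v(1), of vs, folded bv] have hdws: "hd ws = v" unfolding ws_def .
  have orth: "corthogonal_mat W" using orthogonal_mat_of_cols ws unfolding W_def by blast
  have W: "W \<in> carrier_mat n n" using ws unfolding W_def by auto
  have [simp]: "dim_row W = n" "dim_col W = n" using W by auto
  have colW0: "col W 0 = v"
    using ws n hdws v(1) unfolding W_def by (subst col_mat_of_cols) (auto simp: hd_conv_nth)
  define s where "s = (\<lambda>j. 1 / complex_of_real (sqrt (Re (braket (col W j) (col W j)))))"
  \<comment> \<open>Orthogonality is an equivalence here: products of distinct columns vanish and no
    column does, so the normalisation never divides by zero.\<close>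
  have orth': "braket (col W i) (col W j) = 0 \<longleftrightarrow> i \<noteq> j" if "i < n" "j < n" for i j
    using corthogonal_matD[OF orth, of j i] that by (auto simp: braket_def)
  have pos: "0 < Re (braket (col W j) (col W j))" if "j < n" for j
    using orth'[OF that that] braket_self[of "col W j"] braket_self_nonneg[of "col W j"]
    by (metis less_le of_real_0 Re_complex_of_real)
  have s: "cnj (s j) * (s j * braket (col W j) (col W j)) = 1" if "j < n" for j
  proof -
    define q where "q = complex_of_real (sqrt (Re (braket (col W j) (col W j))))"
    have "q * q = of_real (Re (braket (col W j) (col W j)))"
      using pos[OF that] unfolding q_def of_real_mult[symmetric] by simp
    hence "braket (col W j) (col W j) = q * q" by (simp add: braket_self)
    moreover have "q \<noteq> 0" "cnj q = q" using pos[OF that] by (auto simp: q_def)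
    ultimately show ?thesis unfolding s_def q_def[symmetric] by simp
  qed
  define Q where "Q = mat n n (\<lambda>(i, j). s j * W $$ (i, j))"
  have [simp]: "dim_row Q = n" "dim_col Q = n" by (auto simp: Q_def)
  have colQ: "col Q j = s j \<cdot>\<^sub>v col W j" if "j < n" for j
    using that by (intro eq_vecI) (auto simp: Q_def)
  have "Q\<^sup>\<dagger> * Q = 1\<^sub>m n"
  proof (rule eq_matI)
    fix i j assume "i < dim_row (1\<^sub>m n :: complex mat)" "j < dim_col (1\<^sub>m n :: complex mat)"
    hence ij: "i < n" "j < n" by auto
    have "(Q\<^sup>\<dagger> * Q) $$ (i, j) = cnj (s i) * (s j * braket (col W i) (col W j))"
      using ij by (simp add: adjoint_mult_index colQ braket_sum sum_distrib_left algebra_simps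
        del: index_mult_mat(1))
    also have "\<dots> = (1\<^sub>m n) $$ (i, j)" using orth'[OF ij] s[OF ij(1)] ij by auto
    finally show "(Q\<^sup>\<dagger> * Q) $$ (i, j) = (1\<^sub>m n) $$ (i, j)" .
  qed auto
  hence "unitary_mat n Q" by (intro unitary_matI) (auto simp: Q_def)
  moreover have "s 0 \<noteq> 0" using s[OF n] by auto
  ultimately show ?thesis using that colQ[OF n] colW0 by auto
qed

lemma four_block_diag_mult:
  fixes A1 A2 B1 B2 :: "complex mat"
  assumes "A1 \<in> carrier_mat k k" "A2 \<in> carrier_mat n n" "B1 \<in> carrier_mat k k" "B2 \<in> carrier_mat n n"
  shows "four_block_mat A1 (0\<^sub>m k n) (0\<^sub>m n k) A2 * four_block_mat B1 (0\<^sub>m k n) (0\<^sub>m n k) B2 =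
    four_block_mat (A1 * B1) (0\<^sub>m k n) (0\<^sub>m n k) (A2 * B2)"
  by (subst mult_four_block_mat[OF assms(1) zero_carrier_mat zero_carrier_mat assms(2)
        assms(3) zero_carrier_mat zero_carrier_mat assms(4)])
    (use assms in \<open>auto intro!: cong_four_block_mat\<close>)

lemma four_block_diag_adjoint:
  fixes A1 A2 :: "complex mat"
  assumes "A1 \<in> carrier_mat k k" "A2 \<in> carrier_mat n n"
  shows "(four_block_mat A1 (0\<^sub>m k n) (0\<^sub>m n k) A2)\<^sup>\<dagger> =
    four_block_mat (A1\<^sup>\<dagger>) (0\<^sub>m k n) (0\<^sub>m n k) (A2\<^sup>\<dagger>)"
  using assms by (intro eq_matI) auto

text \<open>Induction by deflation. A unitary \<open>Q\<close> whose first column is an eigenvector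
  turns \<open>A\<close> into a matrix \<open>B\<close> whose first column is zero below the
  eigenvalue \<open>k\<close>. Since \<open>B\<close> is Hermitian, \<open>k\<close> is real and the
  first row is zero beyond \<open>k\<close> as well, so the induction hypothesis applies to the
  remaining block.\<close>

theorem hermitian_spectral:
  assumes "hermitian_mat n A"
  shows "\<exists>U d. unitary_mat n U \<and> A = U * real_diag n d * U\<^sup>\<dagger>"
  using assms
proof (induction n arbitrary: A)
  case 0
  hence "A \<in> carrier_mat 0 0" by (auto simp: hermitian_mat_def)
  hence "A = 1\<^sub>m 0 * real_diag 0 (\<lambda>_. 0) * (1\<^sub>m 0)\<^sup>\<dagger>" by (intro eq_matI) auto
  moreover have "unitary_mat 0 (1\<^sub>m 0)" by (auto simp: unitary_mat_def)
  ultimately show ?case by blast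
next
  case (Suc n)
  let ?N = "Suc n"
  from Suc.prems have A: "A \<in> carrier_mat ?N ?N" and Ah: "A\<^sup>\<dagger> = A"
    by (auto simp: hermitian_mat_def)
  have [simp]: "dim_row A = ?N" "dim_col A = ?N" using A by auto
  obtain k where "k \<in> spectrum A" using spectrum_non_empty[OF A] by auto
  then obtain v where "eigenvector A v k" by (auto simp: spectrum_def eigenvalue_def)
  hence v: "v \<in> carrier_vec ?N" "v \<noteq> 0\<^sub>v ?N" and Av: "A *\<^sub>v v = k \<cdot>\<^sub>v v"
    by (auto simp: eigenvector_def)
  obtain Q c where Q: "unitary_mat ?N Q" and c: "c \<noteq> 0" and Q0: "col Q 0 = c \<cdot>\<^sub>v v"
    using unitary_completion[OF v] by blast
  note [simp] = unitary_matD[OF Q]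
  define B where "B = Q\<^sup>\<dagger> * (A * Q)"
  have [simp]: "dim_row B = ?N" "dim_col B = ?N" by (auto simp: B_def)
  have Bh: "B\<^sup>\<dagger> = B" by (simp add: B_def mat_adjoint_mult mat_assoc_dim Ah)
  have B0: "B $$ (i, 0) = (if i = 0 then k else 0)" if i: "i < ?N" for i
  proof -
    have "col (A * Q) 0 = k \<cdot>\<^sub>v col Q 0"
      using v(1) by (subst col_mult2[OF A unitary_matD(1)[OF Q]])
        (simp_all add: Q0 mult_mat_vec[OF A] Av smult_smult_assoc mult.commute)
    hence "B $$ (i, 0) = k * braket (col Q i) (col Q 0)"
      using i v unfolding B_def
      by (simp add: adjoint_mult_index braket_sum sum_distrib_left algebra_simps
          del: index_mult_mat(1) col_mult2)
    also have "braket (col Q i) (col Q 0) = (Q\<^sup>\<dagger> * Q) $$ (i, 0)"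
      using i by (subst adjoint_mult_index) auto
    finally show ?thesis using i by simp
  qed
  have Bconj: "B $$ (i, j) = cnj (B $$ (j, i))" if "i < ?N" "j < ?N" for i j
    using that mat_adjoint_index[of i B j] by (simp add: Bh)
  have "cnj k = k" using Bconj[of 0 0] B0[of 0] by simp
  hence k: "k = of_real (Re k)" by (simp add: complex_eq_iff)
  define B' where "B' = mat n n (\<lambda>(i, j). B $$ (Suc i, Suc j))"
  have B'c: "B' \<in> carrier_mat n n" by (simp add: B'_def)
  let ?blk = "\<lambda>X Y. four_block_mat X (0\<^sub>m 1 n) (0\<^sub>m n 1) Y"
  let ?k = "mat 1 1 (\<lambda>_. k)"
  have Bblk: "B = ?blk ?k B'"
    using B0 Bconj[of 0] \<open>cnj k = k\<close> by (intro eq_matI) (auto simp: B'_def)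
  have "hermitian_mat n B'"
    unfolding hermitian_mat_def
    by (auto simp: B'_def Bconj[symmetric] intro!: eq_matI)
  then obtain U d where U: "unitary_mat n U" and B': "B' = U * real_diag n d * U\<^sup>\<dagger>"
    using Suc.IH by blast
  note U' = unitary_matD[OF U]
  define V where "V = ?blk (1\<^sub>m 1) U"
  \<comment> \<open>The eigenvalues of the remaining block move up by one position, behind the
    eigenvalue split off.\<close>
  define e where "e = (\<lambda>i. case i of 0 \<Rightarrow> Re k | Suc j \<Rightarrow> d j)"
  have Vh: "V\<^sup>\<dagger> = ?blk (1\<^sub>m 1) (U\<^sup>\<dagger>)"
    unfolding V_def using U'(1) by (subst four_block_diag_adjoint) auto
  have e: "real_diag ?N e = ?blk ?k (real_diag n d)"
    using k by (intro eq_matI) (auto simp: e_def split: nat.split)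
  have V: "unitary_mat ?N V"
  proof (rule unitary_matI)
    show "V \<in> carrier_mat ?N ?N" using U'(1-3) by (auto simp: V_def intro!: carrier_matI)
    show "V\<^sup>\<dagger> * V = 1\<^sub>m ?N"
      unfolding Vh unfolding V_def using U'(1-5) by (subst four_block_diag_mult) auto
  qed
  note [simp] = unitary_matD[OF V]
  have rd: "real_diag n d \<in> carrier_mat n n" by (auto intro!: carrier_matI)
  have "V * real_diag ?N e * V\<^sup>\<dagger> = B"
    unfolding Vh e unfolding V_def Bblk B' using U'(1-3) rd
    by (subst four_block_diag_mult, auto)+
  hence "Q * V * real_diag ?N e * (Q * V)\<^sup>\<dagger> = Q * B * Q\<^sup>\<dagger>"
    by (simp add: mat_adjoint_mult mat_assoc_dim flip: \<open>V * real_diag ?N e * V\<^sup>\<dagger> = B\<close>)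
  also have "\<dots> = A" by (simp add: B_def mat_assoc_dim)
  finally show ?case using unitary_mat_mult[OF Q V] by metis
qed

lemma psd_mat_diag_nonneg:
  assumes A: "psd_mat n A" and i: "i < n"
  shows "0 \<le> Re (A $$ (i, i))"
proof -
  have "A *\<^sub>v unit_vec n i = col A i"
    using psd_matD(1-3)[OF A] i by (intro eq_vecI) auto
  moreover have "braket (unit_vec n i) (col A i) = A $$ (i, i)"
    using psd_matD(2,3)[OF A] i
    by (simp add: braket_sum unit_vec_def if_distrib if_distribR cong: if_cong)
  ultimately show ?thesis using psd_matD(5)[OF A, of "unit_vec n i"] i by simp
qed

lemma psd_mat_real_diag:
  assumes "\<And>i. i < n \<Longrightarrow> 0 \<le> d i"
  shows "psd_mat n (real_diag n d)"
proof -
  have "real_diag n d = (real_diag n (\<lambda>i. sqrt (d i)))\<^sup>\<dagger> * real_diag n (\<lambda>i. sqrt (d i))"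
    using assms by (intro eq_matI) (simp_all add: real_diag_mult del: index_mult_mat(1))
  thus ?thesis by (metis carrier_matI psd_mat_adjoint_mult_self real_diag_simps(1,2))
qed

lemma psd_mat_sqrt_ex:
  assumes "psd_mat n A"
  shows "\<exists>S. psd_mat n S \<and> S * S = A"
proof -
  obtain U d where U: "unitary_mat n U" and A: "A = U * real_diag n d * U\<^sup>\<dagger>"
    using hermitian_spectral assms unfolding psd_mat_def by blast
  note [simp] = unitary_matD[OF U]
  have UAU: "U\<^sup>\<dagger> * A * U = real_diag n d" by (simp add: A mat_assoc_dim)
  have d: "0 \<le> d i" if "i < n" for i
    using psd_mat_diag_nonneg[OF psd_mat_congruence[OF assms unitary_matD(1)[OF U]] that] that
    unfolding UAU by simp
  define S where "S = U * real_diag n (\<lambda>i. sqrt (d i)) * U\<^sup>\<dagger>"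
  have "psd_mat n S"
    using psd_mat_congruence[OF psd_mat_real_diag, of n "\<lambda>i. sqrt (d i)" "U\<^sup>\<dagger>" n] d
    by (simp add: S_def)
  moreover have "real_diag n (\<lambda>i. sqrt (d i)) * real_diag n (\<lambda>i. sqrt (d i)) = real_diag n d"
    using d by (intro eq_matI) (simp_all add: real_diag_mult del: index_mult_mat(1) flip: of_real_mult)
  hence "S * S = A"
    by (simp add: S_def A mat_assoc_dim mat_assoc_cong[of "real_diag n (\<lambda>i. sqrt (d i))"])
  ultimately show ?thesis by blast
qed

text \<open>A single diagonalisation, that of \<open>S - T\<close>, suffices. In its eigenbasis
  \<open>S' (S' - T') + (S' - T') T'\<close> is \<open>S'\<^sup>2 - T'\<^sup>2 = 0\<close>, and its
  diagonal entry is \<open>d i\<close> times the sum of the diagonal entries of \<open>S'\<close>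
  and \<open>T'\<close>. If that sum is zero, both entries are zero, being nonnegative, and then so
  is their difference \<open>d i\<close>.\<close>

lemma psd_mat_sqrt_unique:
  assumes S: "psd_mat n S" and T: "psd_mat n T" and ST: "S * S = T * T"
  shows "S = T"
proof -
  note [simp] = psd_matD(1-4)[OF S] psd_matD(1-4)[OF T]
  have "hermitian_mat n (S - T)"
    by (auto simp: hermitian_mat_def mat_adjoint_diff intro!: carrier_matI)
  then obtain V d where V: "unitary_mat n V" and D: "S - T = V * real_diag n d * V\<^sup>\<dagger>"
    using hermitian_spectral by blast
  note [simp] = unitary_matD[OF V]
  define S' T' where "S' = V\<^sup>\<dagger> * S * V" and "T' = V\<^sup>\<dagger> * T * V"
  have [simp]: "dim_row S' = n" "dim_col S' = n" "dim_row T' = n" "dim_col T' = n"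
    by (auto simp: S'_def T'_def)
  have S': "psd_mat n S'" and T': "psd_mat n T'"
    unfolding S'_def T'_def by (rule psd_mat_congruence[OF S] psd_mat_congruence[OF T], simp)+
  have diff: "S' - T' = real_diag n d"
  proof -
    have "S' - T' = V\<^sup>\<dagger> * (S - T) * V" by (simp add: S'_def T'_def mat_distrib_dim)
    thus ?thesis by (simp add: D mat_assoc_dim)
  qed
  have sq: "S' * S' = T' * T'"
    using ST by (simp add: S'_def T'_def mat_assoc_dim mat_assoc_cong[OF ST])
  have "S' * (S' - T') + (S' - T') * T' = 0\<^sub>m n n"
    by (simp add: mat_distrib_dim sq) (auto intro!: eq_matI)
  hence zero: "S' * real_diag n d + real_diag n d * T' = 0\<^sub>m n n" by (simp add: diff)
  have "d i = 0" if i: "i < n" for i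
  proof -
    have "(S' * real_diag n d + real_diag n d * T') $$ (i, i) = of_real (d i) * (S' $$ (i, i) + T' $$ (i, i))"
    proof -
      have "(S' * real_diag n d) $$ (i, i) = (\<Sum>k<n. if k = i then S' $$ (i, i) * of_real (d i) else 0)"
        using i by (subst mat_mult_index_sum) (auto simp del: sum.delta sum.delta' intro!: sum.cong)
      moreover have "(real_diag n d * T') $$ (i, i) = (\<Sum>k<n. if k = i then of_real (d i) * T' $$ (i, i) else 0)"
        using i by (subst mat_mult_index_sum) (auto simp del: sum.delta sum.delta' intro!: sum.cong)
      ultimately show ?thesis using i by (simp add: algebra_simps)
    qed
    hence "d i = 0 \<or> S' $$ (i, i) + T' $$ (i, i) = 0" using i by (simp add: zero)
    moreover have "S' $$ (i, i) - T' $$ (i, i) = of_real (d i)"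
      using arg_cong[OF diff, of "\<lambda>M. M $$ (i, i)"] i by simp
    ultimately show ?thesis
      using psd_mat_diag_nonneg[OF S' i] psd_mat_diag_nonneg[OF T' i] by (auto simp: complex_eq_iff)
  qed
  hence "S - T = V * 0\<^sub>m n n * V\<^sup>\<dagger>"
    unfolding D by (intro arg_cong2[of _ _ _ _ "(*)"] refl eq_matI) auto
  hence "S - T = 0\<^sub>m (dim_row T) (dim_col T)" by simp
  thus ?thesis by (rule mat_diff_eq_0) auto
qed

section \<open>Consequences of the positive square root\<close>

lemma mat_sqrt_eqI:
  assumes "psd_mat n S" "S * S = A"
  shows "mat_sqrt A = S"
proof -
  have "dim_row A = n" using assms psd_matD(2)[OF assms(1)] by auto
  thus ?thesis unfolding mat_sqrt_def
    using assms psd_mat_sqrt_unique by (intro the_equality) auto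
qed

lemma mat_sqrt:
  assumes "psd_mat n A"
  shows "psd_mat n (mat_sqrt A)" "mat_sqrt A * mat_sqrt A = A"
  using psd_mat_sqrt_ex[OF assms] mat_sqrt_eqI by auto

text \<open>With \<open>F\<close> and \<open>C\<close> the roots of \<open>A\<close> and
  \<open>B\<close>, cyclicity turns the trace into the squared Frobenius norm of
  \<open>F * C\<close>. If it is zero then \<open>F * C\<close> is zero, and \<open>A * B\<close>
  contains this factor.\<close>

lemma psd_mat_trace_mult_nonneg:
  assumes A: "psd_mat n A" and B: "psd_mat n B"
  shows "0 \<le> Re (mat_trace (A * B))"
    and "Re (mat_trace (A * B)) = 0 \<Longrightarrow> A * B = 0\<^sub>m n n"
proof -
  obtain F where F: "psd_mat n F" "F * F = A" using psd_mat_sqrt_ex[OF A] by blast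
  obtain C where C: "psd_mat n C" "C * C = B" using psd_mat_sqrt_ex[OF B] by blast
  note [simp] = psd_matD(2-4)[OF F(1)] psd_matD(2-4)[OF C(1)]
  have AB: "A * B = F * ((F * C) * C)" by (simp add: mat_assoc_dim flip: F(2) C(2))
  have "mat_trace (A * B) = mat_trace (((F * C) * C) * F)"
    unfolding AB by (rule mat_trace_mult_commute) auto
  also have "\<dots> = mat_trace ((F * C) * (F * C)\<^sup>\<dagger>)" by (simp add: mat_adjoint_mult mat_assoc_dim)
  also have "\<dots> = mat_trace ((F * C)\<^sup>\<dagger> * (F * C))" by (rule mat_trace_mult_commute) auto
  finally have tr: "mat_trace (A * B) = mat_trace ((F * C)\<^sup>\<dagger> * (F * C))" .
  show "0 \<le> Re (mat_trace (A * B))"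
    unfolding tr mat_trace_adjoint_mult_self by (simp add: sum_nonneg)
  assume "Re (mat_trace (A * B)) = 0"
  hence "F * C = 0\<^sub>m n n" using mat_adjoint_mult_self_eq_0[of "F * C"] unfolding tr by simp
  thus "A * B = 0\<^sub>m n n"
    unfolding AB using psd_matD(1)[OF F(1)] psd_matD(1)[OF C(1)] by simp
qed

lemma braket_adjoint_mult_self:
  assumes "dim_col C = dim_vec v"
  shows "braket v (C\<^sup>\<dagger> * C *\<^sub>v v) = braket (C *\<^sub>v v) (C *\<^sub>v v)"
  using assms by (simp add: mat_assoc_vec_dim braket_mult_mat[of "C\<^sup>\<dagger>"])

text \<open>The form at \<open>v\<close> is the squared norm of \<open>F *\<^sub>v v\<close> for the
  root \<open>F\<close> of \<open>A\<close>.\<close>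

lemma psd_mat_braket_eq_0:
  assumes A: "psd_mat n A" and v: "v \<in> carrier_vec n" and z: "Re (braket v (A *\<^sub>v v)) = 0"
  shows "A *\<^sub>v v = 0\<^sub>v n"
proof -
  obtain F where F: "psd_mat n F" "F * F = A" using psd_mat_sqrt_ex[OF A] by blast
  note [simp] = psd_matD(2-4)[OF F(1)]
  have [simp]: "dim_vec v = n" using v by auto
  have "Re (braket (F *\<^sub>v v) (F *\<^sub>v v)) = 0"
    using z braket_adjoint_mult_self[of F v] by (simp add: F(2))
  hence "F *\<^sub>v v = 0\<^sub>v n" using braket_self_eq_0[of "F *\<^sub>v v"] by simp
  hence "F *\<^sub>v (F *\<^sub>v v) = 0\<^sub>v n" by (simp add: mat_mult_zero_vec)
  thus ?thesis by (simp add: mat_assoc_vec_dim flip: F(2))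
qed

lemma pd_mat_adjoint_mult_self:
  assumes C: "C \<in> carrier_mat k n"
    and ker: "\<And>v. v \<in> carrier_vec n \<Longrightarrow> C *\<^sub>v v = 0\<^sub>v k \<Longrightarrow> v = 0\<^sub>v n"
  shows "pd_mat n (C\<^sup>\<dagger> * C)"
proof -
  have "0 < Re (braket v (C\<^sup>\<dagger> * C *\<^sub>v v))" if v: "v \<in> carrier_vec n" "v \<noteq> 0\<^sub>v n" for v
    using C v ker[OF v(1)] braket_self_pos[of "C *\<^sub>v v" k]
    by (subst braket_adjoint_mult_self) auto
  thus ?thesis using psd_mat_adjoint_mult_self[OF C] by (auto simp: pd_mat_def psd_mat_def)
qed

lemma pd_mat_sqrt:
  assumes "pd_mat n A"
  shows "pd_mat n (mat_sqrt A)"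
proof -
  let ?S = "mat_sqrt A"
  note S = mat_sqrt[OF pd_mat_imp_psd_mat[OF assms]]
  note [simp] = psd_matD(1-3)[OF S(1)]
  have "0 < Re (braket v (?S *\<^sub>v v))" if v: "v \<in> carrier_vec n" "v \<noteq> 0\<^sub>v n" for v
  proof (rule ccontr)
    assume "\<not> ?thesis"
    hence "?S *\<^sub>v v = 0\<^sub>v n" using psd_matD(5)[OF S(1) v(1)] psd_mat_braket_eq_0[OF S(1) v(1)] by auto
    hence "?S * ?S *\<^sub>v v = 0\<^sub>v n" using v by (simp add: mat_assoc_vec_dim mat_mult_zero_vec)
    thus False using pd_mat_kernel[OF assms v(1)] v(2) by (simp add: S(2))
  qed
  thus ?thesis using S(1) by (auto simp: pd_mat_def psd_mat_def)
qed

subsection \<open>Sums of matrices\<close>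

context
  fixes n :: nat and I :: "'i set" and f :: "'i \<Rightarrow> complex mat"
  assumes I: "finite I" and f: "\<And>i. i \<in> I \<Longrightarrow> f i \<in> carrier_mat n n"
begin

interpretation abelian_group "module_mat TYPE(complex) n n"
  by (rule abelian_group_mat)

lemma mat_sum_carrier: "mat_sum n f I \<in> carrier_mat n n"
  using finsum_closed[of f I] f by (auto simp: module_mat_simps)

lemma mat_sum_dim: "dim_row (mat_sum n f I) = n" "dim_col (mat_sum n f I) = n"
  using mat_sum_carrier by auto

text \<open>\<open>finsum\<close> is taken in the abstract module of matrices; passing to entries
  turns it into ordinary sums of complex numbers, for which the linearity facts below are exchanges
  of summation.\<close>

lemma mat_sum_index:
  assumes ab: "a < n" "b < n"
  shows "mat_sum n f I $$ (a, b) = (\<Sum>i\<in>I. f i $$ (a, b))"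
  using I f
proof (induction I)
  case empty
  then show ?case using ab by (simp add: module_mat_simps)
next
  case (insert x F)
  have fF: "f \<in> F \<rightarrow> carrier (module_mat TYPE(complex) n n)" "f x \<in> carrier (module_mat TYPE(complex) n n)"
    using insert.prems by (auto simp: module_mat_simps)
  have "mat_sum n f F \<in> carrier_mat n n"
    using finsum_closed[OF fF(1)] by (simp add: module_mat_simps)
  then show ?case
    using insert ab finsum_insert[OF insert.hyps fF] by (simp add: module_mat_simps)
qed

lemma mat_trace_mat_sum: "mat_trace (mat_sum n f I) = (\<Sum>i\<in>I. mat_trace (f i))"
proof -
  have "mat_trace (mat_sum n f I) = (\<Sum>a<n. \<Sum>i\<in>I. f i $$ (a, a))"
    unfolding mat_trace_def mat_sum_dim by (intro sum.cong) (auto simp: mat_sum_index)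
  also have "\<dots> = (\<Sum>i\<in>I. \<Sum>a<n. f i $$ (a, a))" by (rule sum.swap)
  also have "\<dots> = (\<Sum>i\<in>I. mat_trace (f i))"
    using f unfolding mat_trace_def by (intro sum.cong) auto
  finally show ?thesis .
qed

end

lemma mat_sum_eqI:
  assumes "finite I" "\<And>i. i \<in> I \<Longrightarrow> f i \<in> carrier_mat n n" "dim_row A = n" "dim_col A = n"
    "\<And>a b. a < n \<Longrightarrow> b < n \<Longrightarrow> A $$ (a, b) = (\<Sum>i\<in>I. f i $$ (a, b))"
  shows "A = mat_sum n f I"
  using assms mat_sum_dim[of I f n] mat_sum_index[of I f n] by (intro eq_matI) auto

lemma mat_sum_cong:
  assumes "finite I" "\<And>i. i \<in> I \<Longrightarrow> g i \<in> carrier_mat n n" "\<And>i. i \<in> I \<Longrightarrow> f i = g i"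
  shows "mat_sum n f I = mat_sum n g I"
  using assms mat_sum_dim[of I f n] mat_sum_index[of I f n] by (intro mat_sum_eqI) auto

lemma mat_sum_mult_left:
  assumes I: "finite I" and f: "\<And>i. i \<in> I \<Longrightarrow> f i \<in> carrier_mat n n" and A: "A \<in> carrier_mat n n"
  shows "A * mat_sum n f I = mat_sum n (\<lambda>i. A * f i) I"
proof (rule mat_sum_eqI[OF I])
  note [simp] = mat_sum_dim[OF I f]
  have [simp]: "dim_row A = n" "dim_col A = n" using A by auto
  show "A * f i \<in> carrier_mat n n" if "i \<in> I" for i using A f[OF that] by simp
  show "dim_row (A * mat_sum n f I) = n" "dim_col (A * mat_sum n f I) = n" by auto
  fix a b assume ab: "a < n" "b < n"
  have "(A * mat_sum n f I) $$ (a, b) = (\<Sum>k<n. A $$ (a, k) * (\<Sum>i\<in>I. f i $$ (k, b)))"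
    using ab by (subst mat_mult_index_sum) (auto simp: mat_sum_index[OF I f])
  also have "\<dots> = (\<Sum>i\<in>I. \<Sum>k<n. A $$ (a, k) * f i $$ (k, b))"
    unfolding sum_distrib_left by (rule sum.swap)
  also have "\<dots> = (\<Sum>i\<in>I. (A * f i) $$ (a, b))"
  proof (rule sum.cong[OF refl])
    fix i assume "i \<in> I"
    from f[OF this] have "dim_row (f i) = n" "dim_col (f i) = n" by auto
    thus "(\<Sum>k<n. A $$ (a, k) * f i $$ (k, b)) = (A * f i) $$ (a, b)"
      using ab by (subst mat_mult_index_sum) auto
  qed
  finally show "(A * mat_sum n f I) $$ (a, b) = (\<Sum>i\<in>I. (A * f i) $$ (a, b))" .
qed

lemma mat_sum_mult_right:
  assumes I: "finite I" and f: "\<And>i. i \<in> I \<Longrightarrow> f i \<in> carrier_mat n n" and A: "A \<in> carrier_mat n n"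
  shows "mat_sum n f I * A = mat_sum n (\<lambda>i. f i * A) I"
proof (rule mat_sum_eqI[OF I])
  note [simp] = mat_sum_dim[OF I f]
  have [simp]: "dim_row A = n" "dim_col A = n" using A by auto
  show "f i * A \<in> carrier_mat n n" if "i \<in> I" for i using A f[OF that] by simp
  show "dim_row (mat_sum n f I * A) = n" "dim_col (mat_sum n f I * A) = n" by auto
  fix a b assume ab: "a < n" "b < n"
  have "(mat_sum n f I * A) $$ (a, b) = (\<Sum>k<n. (\<Sum>i\<in>I. f i $$ (a, k)) * A $$ (k, b))"
    using ab by (subst mat_mult_index_sum) (auto simp: mat_sum_index[OF I f])
  also have "\<dots> = (\<Sum>i\<in>I. \<Sum>k<n. f i $$ (a, k) * A $$ (k, b))"
    unfolding sum_distrib_right by (rule sum.swap)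
  also have "\<dots> = (\<Sum>i\<in>I. (f i * A) $$ (a, b))"
  proof (rule sum.cong[OF refl])
    fix i assume "i \<in> I"
    from f[OF this] have "dim_row (f i) = n" "dim_col (f i) = n" by auto
    thus "(\<Sum>k<n. f i $$ (a, k) * A $$ (k, b)) = (f i * A) $$ (a, b)"
      using ab by (subst mat_mult_index_sum) auto
  qed
  finally show "(mat_sum n f I * A) $$ (a, b) = (\<Sum>i\<in>I. (f i * A) $$ (a, b))" .
qed

subsection \<open>The optimality criterion\<close>

lemma ketbra_dim [simp]: "dim_row (ketbra v w) = dim_vec v" "dim_col (ketbra v w) = dim_vec w"
  by (auto simp: ketbra_def)

lemma psd_mat_ketbra:
  assumes "v \<in> carrier_vec n"
  shows "psd_mat n (ketbra v v)"
proof -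
  let ?C = "mat 1 n (\<lambda>(_, b). cnj (v $ b))"
  have "ketbra v v = ?C\<^sup>\<dagger> * ?C"
    using assms by (intro eq_matI)
      (auto simp: ketbra_def mat_mult_index_sum simp del: index_mult_mat(1))
  thus ?thesis using psd_mat_adjoint_mult_self[of ?C 1 n] by simp
qed

lemma ketbra_mult_self: "ketbra v v * ketbra v v = of_real (Re (braket v v)) \<cdot>\<^sub>m ketbra v v"
proof -
  have "of_real (Re (braket v v)) = braket v v" by (simp add: braket_self)
  thus ?thesis
    by (intro eq_matI)
      (auto simp: ketbra_def mat_mult_index_sum braket_sum sum_distrib_left sum_distrib_right
         mult_ac simp del: index_mult_mat(1))
qed

text \<open>The first-order optimality test: the inequality is available for small positive
  \<open>e\<close> only; divided by \<open>e\<close>, it tends to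
  \<open>2 * a \<le> 0\<close>.\<close>

lemma quadratic_nonpos_imp_linear_nonpos:
  fixes a c e0 :: real
  assumes e0: "0 < e0" and le: "\<And>e. 0 < e \<Longrightarrow> e \<le> e0 \<Longrightarrow> 2 * a * e + c * e\<^sup>2 \<le> 0"
  shows "a \<le> 0"
proof (rule ccontr)
  assume "\<not> a \<le> 0"
  hence a: "0 < a" by simp
  \<comment> \<open>Chosen so that \<open>\<bar>c\<bar> * e\<close> stays below \<open>a\<close>;
    the linear term then outweighs the quadratic one. The summand 1 covers
    \<open>c = 0\<close>.\<close>
  define e where "e = min e0 (a / (\<bar>c\<bar> + 1))"
  have e: "0 < e" "e \<le> e0" using a e0 by (auto simp: e_def)
  have "e * (\<bar>c\<bar> + 1) \<le> a" by (simp add: e_def pos_le_divide_eq[symmetric])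
  moreover have "- (c * e) \<le> e * (\<bar>c\<bar> + 1)" using e(1)
    by (smt (verit, best) mult.commute mult_minus_left mult_right_mono)
  ultimately have "0 < 2 * a + c * e" using a by linarith
  hence "0 < e * (2 * a + c * e)" using e(1) by simp
  thus False using le[OF e] by (simp add: power2_eq_square algebra_simps)
qed

section \<open>Weak duality, perturbation of an optimal measurement, complementary slackness\<close>

context
  fixes n m :: nat and p :: "nat \<Rightarrow> real" and \<rho> E :: "nat \<Rightarrow> complex mat"
  assumes rho: "\<And>i. i < m \<Longrightarrow> hermitian_mat n (\<rho> i)" and E: "is_povm n m E"
begin

private abbreviation (input) "R \<equiv> \<lambda>i. complex_of_real (p i) \<cdot>\<^sub>m \<rho> i"

private lemma R: "i < m \<Longrightarrow> R i \<in> carrier_mat n n" "i < m \<Longrightarrow> dim_row (\<rho> i) = n"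
    "i < m \<Longrightarrow> dim_col (\<rho> i) = n" "i < m \<Longrightarrow> (R i)\<^sup>\<dagger> = R i"
  using rho[of i] by (auto simp: hermitian_mat_def mat_adjoint_smult)

private lemma povmD:
  assumes "is_povm n m E'"
  shows "i < m \<Longrightarrow> psd_mat n (E' i)" "i < m \<Longrightarrow> E' i \<in> carrier_mat n n"
    "i < m \<Longrightarrow> dim_row (E' i) = n" "i < m \<Longrightarrow> dim_col (E' i) = n" "i < m \<Longrightarrow> (E' i)\<^sup>\<dagger> = E' i"
    "mat_sum n E' {..<m} = 1\<^sub>m n"
  using assms psd_matD[of n "E' i"] unfolding is_povm_def by auto

private lemma success_prob_alt:
  assumes "is_povm n m E'"
  shows "success_prob m p \<rho> E' = (\<Sum>i<m. Re (mat_trace (R i * E' i)))"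
  unfolding success_prob_def using R povmD[OF assms]
  by (intro sum.cong) (auto simp: mat_smult_dim mat_trace_smult)

private lemma trace_mult_povm:
  assumes "is_povm n m E'" "K \<in> carrier_mat n n"
  shows "mat_trace K = (\<Sum>i<m. mat_trace (K * E' i))"
proof -
  have "K = K * mat_sum n E' {..<m}" using assms(2) povmD[OF assms(1)] by simp
  also have "\<dots> = mat_sum n (\<lambda>i. K * E' i) {..<m}"
    using assms povmD[OF assms(1)] by (intro mat_sum_mult_left) auto
  also have "mat_trace \<dots> = (\<Sum>i<m. mat_trace (K * E' i))"
    using assms povmD[OF assms(1)] by (intro mat_trace_mat_sum) auto
  finally show ?thesis .
qed

text \<open>The duality gap. If \<open>K\<close> dominates every weighted state, each summand is
  nonnegative, so the trace of \<open>K\<close> bounds all success probabilities; the bound is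
  attained when every summand vanishes.\<close>

private lemma sum_trace_diff:
  assumes E': "is_povm n m E'" and K: "K \<in> carrier_mat n n"
  shows "(\<Sum>i<m. Re (mat_trace ((K - R i) * E' i))) = Re (mat_trace K) - success_prob m p \<rho> E'"
proof -
  have [simp]: "dim_row K = n" "dim_col K = n" using K by auto
  have "Re (mat_trace ((K - R i) * E' i)) = Re (mat_trace (K * E' i)) - Re (mat_trace (R i * E' i))"
    if "i < m" for i
    using povmD[OF E'] R that by (simp add: mat_distrib_dim mat_trace_diff)
  thus ?thesis
    by (simp add: success_prob_alt[OF E'] trace_mult_povm[OF E' K] sum_subtractf)
qed

private lemma med_optimal_sufficient:
  assumes K: "K \<in> carrier_mat n n"
    and psd: "\<And>i. i < m \<Longrightarrow> psd_mat n (K - R i)" and eq: "\<And>i. i < m \<Longrightarrow> K * E i = R i * E i"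
  shows "med_optimal n m p \<rho> E"
  unfolding med_optimal_def
proof (intro conjI allI impI)
  fix E' assume E': "is_povm n m E'"
  have "success_prob m p \<rho> E = Re (mat_trace K)"
    using trace_mult_povm[OF E K] eq by (simp add: success_prob_alt[OF E])
  moreover have "0 \<le> (\<Sum>i<m. Re (mat_trace ((K - R i) * E' i)))"
    by (intro sum_nonneg psd_mat_trace_mult_nonneg(1)[OF psd povmD(1)[OF E']]) auto
  ultimately show "success_prob m p \<rho> E' \<le> success_prob m p \<rho> E"
    unfolding sum_trace_diff[OF E' K] by simp
qed (rule E)

text \<open>The perturbed measurement is that of Barnett and Croke: \<open>E\<close> is compressed by
  \<open>1 - e |v><v|\<close> and the missing multiple of \<open>|v><v|\<close> is given to outcome \<open>j\<close>.\<close>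
private lemma med_optimal_quadratic_form:
  assumes opt: "med_optimal n m p \<rho> E" and j: "j < m" and v: "v \<in> carrier_vec n"
  shows "Re (braket v (R j *\<^sub>v v)) \<le> Re (braket v (mat_sum n (\<lambda>i. R i * E i) {..<m} *\<^sub>v v))"
    (is "_ \<le> Re (braket v (?K *\<^sub>v v))")
proof -
  note [simp] = R povmD(3-5)[OF E]
  define t where "t = Re (braket v v)"
  have t: "0 \<le> t" by (simp add: t_def)
  define Q where "Q = ketbra v v"
  have Q: "psd_mat n Q" unfolding Q_def by (rule psd_mat_ketbra[OF v])
  note [simp] = psd_matD(1-4)[OF Q]
  have [simp]: "dim_vec v = n" using v by auto
  have QQ: "Q * Q = of_real t \<cdot>\<^sub>m Q" unfolding Q_def t_def by (rule ketbra_mult_self)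
  have trQ: "mat_trace (A * Q) = braket v (A *\<^sub>v v)" if "dim_row A = n" "dim_col A = n" for A
    unfolding Q_def using that by (intro mat_trace_mult_ketbra) auto
  have RE: "R i * E i \<in> carrier_mat n n" if "i < m" for i using that by (auto intro!: carrier_matI)
  have REQ: "(\<Sum>i<m. Re (braket v (R i * E i *\<^sub>v v))) = Re (braket v (?K *\<^sub>v v))"
  proof -
    have "braket v (?K *\<^sub>v v) = mat_trace (?K * Q)"
      using RE by (intro trQ[symmetric] mat_sum_dim) auto
    also have "?K * Q = mat_sum n (\<lambda>i. R i * E i * Q) {..<m}"
      using RE by (intro mat_sum_mult_right) auto
    also have "mat_trace \<dots> = (\<Sum>i<m. mat_trace (R i * E i * Q))"
      using RE by (intro mat_trace_mat_sum) (auto intro!: mult_carrier_mat)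
    also have "\<dots> = (\<Sum>i<m. braket v (R i * E i *\<^sub>v v))"
      by (intro sum.cong refl trQ) auto
    finally show ?thesis by simp
  qed
  define c where "c = (\<Sum>i<m. Re (mat_trace (R i * (Q * (E i * Q)))))"
  have "Re (braket v (R j *\<^sub>v v)) - Re (braket v (?K *\<^sub>v v)) \<le> 0"
  proof (rule quadratic_nonpos_imp_linear_nonpos[where c = "c - t * Re (braket v (R j *\<^sub>v v))"])
    \<comment> \<open>The bound keeps \<open>e * t \<le> 2\<close>, so that the weight
      \<open>s = e * (2 - e * t)\<close> handed to outcome \<open>j\<close> is nonnegative; the 1 in
      the denominator allows \<open>t = 0\<close>.\<close>
    show "0 < 2 / (t + 1)" using t by simp
    fix e :: real assume e: "0 < e" "e \<le> 2 / (t + 1)"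
    define T where "T = 1\<^sub>m n - of_real e \<cdot>\<^sub>m Q"
    \<comment> \<open>The multiple of \<open>Q\<close> lost by the compression: \<open>Q * Q\<close>
      is \<open>t\<close> times \<open>Q\<close>, so \<open>T * T\<close> is
      \<open>1 - (2 * e - e\<^sup>2 * t) Q\<close>.\<close>
    define s where "s = 2 * e - e\<^sup>2 * t"
    have "e * t \<le> 2" using e t by (simp add: field_simps)
    hence s: "0 \<le> s" using e(1) unfolding s_def power2_eq_square
      by (metis diff_ge_0_iff_ge less_imp_le mult.assoc mult.commute mult_left_mono)
    have T [simp]: "dim_row T = n" "dim_col T = n" "T\<^sup>\<dagger> = T"
      by (auto simp: T_def mat_adjoint_diff mat_adjoint_smult)
    have Tc: "T \<in> carrier_mat n n" by (intro carrier_matI) auto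
    have TT: "T * T + of_real s \<cdot>\<^sub>m Q = 1\<^sub>m n"
    proof -
      have "T * T = 1\<^sub>m n - of_real e \<cdot>\<^sub>m Q - of_real e \<cdot>\<^sub>m (Q - of_real e \<cdot>\<^sub>m (of_real t \<cdot>\<^sub>m Q))"
        by (simp add: T_def mat_distrib_dim mat_smult_dim QQ)
      thus ?thesis
        by (intro eq_matI) (auto simp: s_def power2_eq_square algebra_simps)
    qed
    define E' where "E' = (\<lambda>i. T * (E i * T) + (if i = j then of_real s \<cdot>\<^sub>m Q else 0\<^sub>m n n))"
    have E': "is_povm n m E'"
      unfolding is_povm_def
    proof (intro conjI allI impI)
      fix i assume i: "i < m"
      have "psd_mat n (T * (E i * T))"
        using psd_mat_congruence[OF povmD(1)[OF E i] Tc] i by (simp add: mat_assoc_dim)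
      moreover have "psd_mat n (if i = j then of_real s \<cdot>\<^sub>m Q else 0\<^sub>m n n)"
        using psd_mat_smult[OF Q s] psd_mat_zero by simp
      ultimately show "psd_mat n (E' i)" unfolding E'_def by (rule psd_mat_add)
    next
      have c1: "E i * T \<in> carrier_mat n n" if "i < m" for i using that by (auto intro!: carrier_matI)
      have c2: "T * (E i * T) \<in> carrier_mat n n" if "i < m" for i using that by (auto intro!: carrier_matI)
      have "T * T = T * (mat_sum n E {..<m} * T)" by (simp add: povmD(6)[OF E])
      also have "mat_sum n E {..<m} * T = mat_sum n (\<lambda>i. E i * T) {..<m}"
        using povmD(2)[OF E] by (intro mat_sum_mult_right) (auto intro!: carrier_matI)
      also have "T * \<dots> = mat_sum n (\<lambda>i. T * (E i * T)) {..<m}"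
        using c1 by (intro mat_sum_mult_left) (auto intro!: carrier_matI)
      finally have TT': "T * T = mat_sum n (\<lambda>i. T * (E i * T)) {..<m}" .
      have "1\<^sub>m n = mat_sum n E' {..<m}"
        unfolding TT[symmetric] TT'
      proof (rule mat_sum_eqI)
        show "E' i \<in> carrier_mat n n" if "i \<in> {..<m}" for i using that by (auto simp: E'_def intro!: carrier_matI)
        fix a b assume ab: "a < n" "b < n"
        have *: "E' i $$ (a, b) = (T * (E i * T)) $$ (a, b) + (if i = j then of_real s * Q $$ (a, b) else 0)"
          if "i < m" for i using ab that by (simp add: E'_def del: index_mult_mat(1))
        show "(mat_sum n (\<lambda>i. T * (E i * T)) {..<m} + of_real s \<cdot>\<^sub>m Q) $$ (a, b) = (\<Sum>i<m. E' i $$ (a, b))"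
          using ab j mat_sum_index[of "{..<m}" "\<lambda>i. T * (E i * T)" n a b] c2
          by (simp add: * sum.distrib del: index_mult_mat(1))
      qed auto
      thus "mat_sum n E' {..<m} = 1\<^sub>m n" by simp
    qed
    have tr: "Re (mat_trace (R i * E' i)) = Re (mat_trace (R i * E i)) - 2 * e * Re (braket v (R i * E i *\<^sub>v v))
        + e\<^sup>2 * Re (mat_trace (R i * (Q * (E i * Q)))) + (if i = j then s * Re (braket v (R j *\<^sub>v v)) else 0)"
      if i: "i < m" for i
    proof -
      \<comment> \<open>The two first-order cross terms are traces of mutually adjoint products, up
        to cyclicity, so their real parts agree and add up to the factor 2.\<close>
      have RQE: "Re (mat_trace (R i * (Q * E i))) = Re (mat_trace (R i * (E i * Q)))"
      proof -
        have "mat_trace (R i * (E i * Q)) = cnj (mat_trace ((R i * (E i * Q))\<^sup>\<dagger>))"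
          using i by (subst mat_trace_adjoint) auto
        also have "(R i * (E i * Q))\<^sup>\<dagger> = (Q * E i) * R i"
          using i R(4)[OF i] by (simp add: mat_adjoint_mult)
        also have "mat_trace \<dots> = mat_trace (R i * (Q * E i))"
          using i by (intro mat_trace_mult_commute) auto
        finally show ?thesis by simp
      qed
      have "A * (T * (F * T)) = A * F - of_real e \<cdot>\<^sub>m (A * (Q * F)) -
          of_real e \<cdot>\<^sub>m (A * (F * Q) - of_real e \<cdot>\<^sub>m (A * (Q * (F * Q))))"
        if "dim_row F = n" "dim_col F = n" "dim_col A = n" for A F
        using that by (simp add: T_def mat_distrib_dim mat_smult_dim)
      from this[of "E i" "R i"] i have "Re (mat_trace (R i * (T * (E i * T)))) = Re (mat_trace (R i * E i))
          - 2 * e * Re (mat_trace (R i * (E i * Q))) + e\<^sup>2 * Re (mat_trace (R i * (Q * (E i * Q))))"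
        using i RQE by (simp add: mat_trace_diff mat_trace_smult power2_eq_square algebra_simps)
      moreover have "R i * (E i * Q) = R i * E i * Q" using i by (simp add: mat_assoc_dim)
      moreover have "Re (mat_trace (R i * (if i = j then of_real s \<cdot>\<^sub>m Q else 0\<^sub>m n n))) =
          (if i = j then s * Re (braket v (R j *\<^sub>v v)) else 0)"
        using j trQ[of "R j"] i R(1)[OF i]
        by (auto simp: mat_smult_dim(2) mat_trace_smult) (simp add: mat_trace_def)
      ultimately show ?thesis
        using i trQ[of "R i * E i"] unfolding E'_def
        by (subst mat_distrib_dim(2)) (auto simp: mat_trace_add)
    qed
    \<comment> \<open>To first order in \<open>e\<close> the compression costs \<open>2 * e\<close>
      times the form of \<open>?K\<close>, and outcome \<open>j\<close> regains \<open>2 * e\<close>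
      times the form of \<open>R j\<close>. The quadratic coefficient collects \<open>c\<close> and
      the \<open>e\<^sup>2\<close> part of \<open>s\<close>.\<close>
    have "success_prob m p \<rho> E' = success_prob m p \<rho> E - 2 * e * Re (braket v (?K *\<^sub>v v)) + e\<^sup>2 * c
        + s * Re (braket v (R j *\<^sub>v v))"
      unfolding success_prob_alt[OF E'] success_prob_alt[OF E] c_def REQ[symmetric]
      using j by (simp add: tr sum.distrib sum_subtractf sum_distrib_left)
    moreover have "success_prob m p \<rho> E' \<le> success_prob m p \<rho> E"
      using opt E' by (auto simp: med_optimal_def)
    ultimately show "2 * (Re (braket v (R j *\<^sub>v v)) - Re (braket v (?K *\<^sub>v v))) * e
        + (c - t * Re (braket v (R j *\<^sub>v v))) * e\<^sup>2 \<le> 0"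
      by (simp add: s_def algebra_simps)
  qed
  thus ?thesis by simp
qed

text \<open>The perturbation argument controls only the real part of the form of
  \<open>\<Sum> R\<^sub>i E\<^sub>i\<close>, which says nothing about its anti-Hermitian part. The
  witness is therefore the Hermitian part \<open>H\<close>: it has the same real form and the same
  real trace.\<close>

private lemma med_optimal_necessary:
  assumes opt: "med_optimal n m p \<rho> E"
  shows "\<exists>K \<in> carrier_mat n n. \<forall>i<m. psd_mat n (K - R i) \<and> K * E i = R i * E i"
proof -
  note [simp] = R povmD(3-5)[OF E]
  define K where "K = mat_sum n (\<lambda>i. R i * E i) {..<m}"
  have RE: "R i * E i \<in> carrier_mat n n" if "i < m" for i using that by (auto intro!: carrier_matI)
  have [simp]: "dim_row K = n" "dim_col K = n" unfolding K_def using RE by (auto intro!: mat_sum_dim)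
  define H where "H = of_real (1 / 2) \<cdot>\<^sub>m (K + K\<^sup>\<dagger>)"
  have Hh: "H\<^sup>\<dagger> = H" by (intro eq_matI) (auto simp: H_def)
  have H: "H \<in> carrier_mat n n" by (auto simp: H_def intro!: carrier_matI)
  have [simp]: "dim_row H = n" "dim_col H = n" using H by auto
  have psd: "psd_mat n (H - R i)" if i: "i < m" for i
  proof -
    have "0 \<le> Re (braket v ((H - R i) *\<^sub>v v))" if v: "v \<in> carrier_vec n" for v
    proof -
      have [simp]: "dim_vec v = n" using v by auto
      have "Re (braket v (H *\<^sub>v v)) = Re (braket v (K *\<^sub>v v))"
        by (simp add: H_def braket_smult_mat braket_add_mat braket_adjoint_mat)
      thus ?thesis using med_optimal_quadratic_form[OF opt i v] i
        by (simp add: braket_diff_mat flip: K_def)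
    qed
    moreover have "hermitian_mat n (H - R i)"
      using i R(4)[OF i] by (auto simp: hermitian_mat_def mat_adjoint_diff Hh intro!: carrier_matI)
    ultimately show ?thesis by (simp add: psd_mat_def)
  qed
  have "Re (mat_trace H) = Re (mat_trace K)"
    by (simp add: H_def mat_trace_smult mat_trace_add mat_trace_adjoint)
  also have "mat_trace K = (\<Sum>i<m. mat_trace (R i * E i))"
    unfolding K_def using RE by (intro mat_trace_mat_sum) auto
  \<comment> \<open>The trace of \<open>H\<close> is the success probability of \<open>E\<close>, so
    the duality gap is zero. As a sum of nonnegative terms it vanishes termwise, and a zero trace of
    two positive factors makes their product zero.\<close>
  finally have "(\<Sum>i<m. Re (mat_trace ((H - R i) * E i))) = 0"
    unfolding sum_trace_diff[OF E H] by (simp add: success_prob_alt[OF E])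
  hence tr0: "Re (mat_trace ((H - R i) * E i)) = 0" if "i < m" for i
    using that psd_mat_trace_mult_nonneg(1)[OF psd povmD(1)[OF E]]
    by (subst (asm) sum_nonneg_eq_0_iff) auto
  have "H * E i = R i * E i" if i: "i < m" for i
  proof -
    have "H * E i - R i * E i = 0\<^sub>m n n"
      using psd_mat_trace_mult_nonneg(2)[OF psd[OF i] povmD(1)[OF E i] tr0[OF i]] i
      by (simp add: mat_distrib_dim)
    thus ?thesis by (intro mat_diff_eq_0[of "H * E i" "R i * E i"]) (use i in auto)
  qed
  thus ?thesis using H psd by blast
qed

text \<open>The Holevo--Yuen--Kennedy--Lax conditions.\<close>
theorem med_optimal_iff:
  "med_optimal n m p \<rho> E \<longleftrightarrow>
    (\<exists>K \<in> carrier_mat n n. \<forall>i<m. psd_mat n (K - R i) \<and> K * E i = R i * E i)"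
  using med_optimal_sufficient med_optimal_necessary by blast

end

subsection \<open>Block structure\<close>

lemma sum_pair_index:
  "(\<Sum>c<(\<Sum>i<m. r i). f c) = (\<Sum>i<m. \<Sum>j<r i. f (pair_index r (i, j)))"
proof (induction m)
  case (Suc m)
  let ?s = "\<Sum>i<m. r i"
  have "(\<Sum>c<?s + t. f c) = (\<Sum>c<?s. f c) + (\<Sum>j<t. f (?s + j))" for t
    by (induction t) (auto simp: add.assoc)
  thus ?case using Suc by (simp add: pair_index_def)
qed simp

lemma pair_index_less: "i < m \<Longrightarrow> j < r i \<Longrightarrow> pair_index r (i, j) < (\<Sum>i<m. r i)"
  using pairs_nth_pair_index(1)[of i m j r] by (simp add: length_pairs)

lemma pair_index_surj:
  assumes "c < (\<Sum>i<m. r i)"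
  shows "\<exists>i j. i < m \<and> j < r i \<and> c = pair_index r (i, j)"
  using assms
proof (induction m)
  case (Suc m)
  show ?case
  proof (cases "c < (\<Sum>i<m. r i)")
    case True
    then obtain i j where "i < m" "j < r i" "c = pair_index r (i, j)" using Suc.IH by blast
    then show ?thesis using less_SucI by blast
  next
    case False
    have "m < Suc m" "c - (\<Sum>i<m. r i) < r m" "c = pair_index r (m, c - (\<Sum>i<m. r i))"
      using False Suc.prems by (auto simp: pair_index_def)
    then show ?thesis by blast
  qed
qed simp

lemma pair_index_eq_iff:
  assumes "i < m" "j < r i" "k < m" "l < r k"
  shows "pair_index r (i, j) = pair_index r (k, l) \<longleftrightarrow> i = k \<and> j = l"
proof
  assume eq: "pair_index r (i, j) = pair_index r (k, l)"
  have "(i, j) = (k, l)"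
    using pairs_nth_pair_index(2)[of i m j r, OF assms(1,2)] pairs_nth_pair_index(2)[of k m l r, OF assms(3,4)]
    unfolding eq by metis
  thus "i = k \<and> j = l" by simp
qed simp

lemma diag_block_mat_dim:
  assumes "\<And>i. i < m \<Longrightarrow> X i \<in> carrier_mat (r i) (r i)"
  shows "dim_row (diag_block_mat (map X [0..<m])) = (\<Sum>i<m. r i)"
    "dim_col (diag_block_mat (map X [0..<m])) = (\<Sum>i<m. r i)"
proof -
  have "map (\<lambda>i. dim_row (X i)) [0..<m] = map r [0..<m]" "map (\<lambda>i. dim_col (X i)) [0..<m] = map r [0..<m]"
    by (auto simp: carrier_matD[OF assms])
  thus "dim_row (diag_block_mat (map X [0..<m])) = (\<Sum>i<m. r i)"
    "dim_col (diag_block_mat (map X [0..<m])) = (\<Sum>i<m. r i)"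
    by (simp_all add: dim_diag_block_mat comp_def interv_sum_list_conv_sum_set_nat atLeast0LessThan)
qed

text \<open>\<open>pair_index\<close> does not involve \<open>m\<close>, so appending a last block
  leaves all earlier positions unchanged and the induction peels blocks off at the end.\<close>

lemma diag_block_mat_index:
  assumes "\<And>i. i < m \<Longrightarrow> X i \<in> carrier_mat (r i) (r i)" "i < m" "j < r i" "k < m" "l < r k"
  shows "diag_block_mat (map X [0..<m]) $$ (pair_index r (i, j), pair_index r (k, l)) =
    (if i = k then X i $$ (j, l) else 0)"
  using assms
proof (induction m)
  case (Suc m)
  let ?D = "diag_block_mat (map X [0..<m])" and ?s = "\<Sum>i<m. r i"
  have X: "\<And>i. i < m \<Longrightarrow> X i \<in> carrier_mat (r i) (r i)" and Xm: "X m \<in> carrier_mat (r m) (r m)"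
    using Suc.prems(1) by auto
  have [simp]: "dim_row ?D = ?s" "dim_col ?D = ?s" "dim_row (X m) = r m" "dim_col (X m) = r m"
    using diag_block_mat_dim[OF X] Xm by auto
  have eq: "diag_block_mat (map X [0..<Suc m]) = four_block_mat ?D (0\<^sub>m ?s (r m)) (0\<^sub>m (r m) ?s) (X m)"
    using diag_block_mat_last[of "map X [0..<m]" "X m"] by (simp add: Let_def)
  have less: "pair_index r (i, j) < ?s" if "i < m" "j < r i" for i j
    using pair_index_less that by auto
  have last: "pair_index r (m, j) = ?s + j" for j by (simp add: pair_index_def)
  have IH: "?D $$ (pair_index r (i, j), pair_index r (k, l)) = (if i = k then X i $$ (j, l) else 0)"
    if "i < m" "k < m"
    using Suc.IH[OF X] that Suc.prems by auto
  show ?case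
    using Suc.prems(2-5) less[of i j] less[of k l] IH unfolding eq
    by (cases "i = m"; cases "k = m") (auto simp: last)
qed simp

text \<open>The isometry of the \<open>i\<close>-th block into the whole space. With it
  \<open>J\<^sup>\<dagger> J\<close> is the identity, \<open>J J\<^sup>\<dagger>\<close> the
  projection onto the block and \<open>J\<^sup>\<dagger> A J\<close> the diagonal block of
  \<open>A\<close>, so arguments about blocks become matrix algebra.\<close>

definition block_embed :: "nat \<Rightarrow> (nat \<Rightarrow> nat) \<Rightarrow> nat \<Rightarrow> complex mat" where
  "block_embed m r i = mat (\<Sum>l<m. r l) (r i) (\<lambda>(a, k). if a = pair_index r (i, k) then 1 else 0)"

definition pair_cols :: "nat \<Rightarrow> nat \<Rightarrow> (nat \<Rightarrow> nat) \<Rightarrow> (nat \<Rightarrow> nat \<Rightarrow> complex vec) \<Rightarrow> complex mat" where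
  "pair_cols n m r v = mat n (\<Sum>l<m. r l) (\<lambda>(a, c). case pairs m r ! c of (l, k) \<Rightarrow> v l k $ a)"

context
  fixes n m :: nat and r :: "nat \<Rightarrow> nat"
  assumes dim: "(\<Sum>i<m. r i) = n"
begin

private abbreviation (input) "J \<equiv> block_embed m r"

lemma block_embed_dim [simp]: "dim_row (J i) = n" "dim_col (J i) = r i"
  by (auto simp: block_embed_def dim)

lemma block_embed_index:
  "a < n \<Longrightarrow> k < r i \<Longrightarrow> J i $$ (a, k) = (if a = pair_index r (i, k) then 1 else 0)"
  by (simp add: block_embed_def dim)

lemma mult_block_embed_index:
  assumes "dim_col A = n" "a < dim_row A" "i < m" "k < r i"
  shows "(A * J i) $$ (a, k) = A $$ (a, pair_index r (i, k))"
proof -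
  have "(A * J i) $$ (a, k) = (\<Sum>b<n. if b = pair_index r (i, k) then A $$ (a, pair_index r (i, k)) else 0)"
    using assms by (subst mat_mult_index_sum) (auto simp: block_embed_def dim simp del: sum.delta intro!: sum.cong)
  thus ?thesis using pair_index_less[of i m k r] assms by (simp add: dim)
qed

lemma col_mult_block_embed:
  assumes "A \<in> carrier_mat n n" "i < m" "k < r i"
  shows "col (A * J i) k = col A (pair_index r (i, k))"
  using assms pair_index_less[of i m k r] dim
  by (intro eq_vecI) (auto simp: mult_block_embed_index simp del: index_mult_mat(1))

lemma adjoint_block_embed_mult_index:
  assumes "dim_row A = n" "b < dim_col A" "i < m" "k < r i"
  shows "((J i)\<^sup>\<dagger> * A) $$ (k, b) = A $$ (pair_index r (i, k), b)"
proof -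
  have "(J i)\<^sup>\<dagger> * A = (A\<^sup>\<dagger> * J i)\<^sup>\<dagger>" using assms by (simp add: mat_adjoint_mult)
  thus ?thesis
    using assms mult_block_embed_index[of "A\<^sup>\<dagger>" b i k] pair_index_less[of i m k r] dim
    by (simp del: index_mult_mat(1))
qed

lemma block_embed_adjoint_mult:
  assumes "i < m" "k < m"
  shows "(J i)\<^sup>\<dagger> * J k = (if i = k then 1\<^sub>m (r i) else 0\<^sub>m (r i) (r k))"
  using assms pair_index_less[of i m _ r] dim by (intro eq_matI)
    (auto simp: adjoint_block_embed_mult_index block_embed_index pair_index_eq_iff[of _ m]
      simp del: index_mult_mat(1))

lemma diag_block_eq:
  assumes "A \<in> carrier_mat n n" "i < m"
  shows "diag_block r A i = (J i)\<^sup>\<dagger> * (A * J i)"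
  using assms pair_index_less[of i m _ r] unfolding dim
  by (intro eq_matI)
    (auto simp: diag_block_def pair_entry_def adjoint_block_embed_mult_index mult_block_embed_index
      simp del: index_mult_mat(1))

lemma mat_eq_blockwise:
  assumes "dim_col A = n" "dim_col B = n" "dim_row A = dim_row B"
    "\<And>i. i < m \<Longrightarrow> A * J i = B * J i"
  shows "A = B"
proof (rule eq_matI)
  fix a c assume ac: "a < dim_row B" "c < dim_col B"
  then obtain i k where ik: "i < m" "k < r i" "c = pair_index r (i, k)"
    using assms(2) pair_index_surj[of c r m] unfolding dim by auto
  have "A $$ (a, c) = (A * J i) $$ (a, k)"
    unfolding ik(3) using assms(1,3) ac ik by (intro mult_block_embed_index[symmetric]) auto
  also have "\<dots> = (B * J i) $$ (a, k)" by (simp only: assms(4)[OF ik(1)])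
  also have "\<dots> = B $$ (a, c)"
    unfolding ik(3) using assms(2) ac ik by (intro mult_block_embed_index) auto
  finally show "A $$ (a, c) = B $$ (a, c)" .
qed (use assms in auto)

lemma vec_zero_blockwise:
  assumes v: "v \<in> carrier_vec n" and z: "\<And>i. i < m \<Longrightarrow> (J i)\<^sup>\<dagger> *\<^sub>v v = 0\<^sub>v (r i)"
  shows "v = 0\<^sub>v n"
proof (rule eq_vecI)
  fix c assume "c < dim_vec (0\<^sub>v n :: complex vec)"
  then obtain i k where ik: "i < m" "k < r i" "c = pair_index r (i, k)" "c < n"
    using pair_index_surj[of c r m] unfolding dim by auto
  have "((J i)\<^sup>\<dagger> *\<^sub>v v) $ k = (\<Sum>b<n. if b = c then v $ c else 0)"
    using ik v by (auto simp: scalar_prod_def atLeast0LessThan block_embed_def dim simp del: sum.delta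
        intro!: sum.cong)
  thus "v $ c = 0\<^sub>v n $ c" using ik z[OF ik(1)] by simp
qed (use v in auto)

context
  fixes X :: "nat \<Rightarrow> complex mat"
  assumes X: "\<And>i. i < m \<Longrightarrow> pd_mat (r i) (X i)"
begin

private abbreviation (input) "D \<equiv> diag_block_mat (map X [0..<m])"

lemma diag_block_mat_carrier: "D \<in> carrier_mat n n"
  using diag_block_mat_dim[of m X r] pd_matD(1)[OF X] dim by (auto intro!: carrier_matI)

private lemma D_dim [simp]: "dim_row D = n" "dim_col D = n"
  using diag_block_mat_carrier by auto

text \<open>This intertwining relation and its adjoint replace the entries of \<open>D\<close> in
  what follows: the trivial kernel, the commutation with the projections and the block equation are
  all derived from them.\<close>

lemma diag_block_mat_mult_embed:
  assumes i: "i < m"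
  shows "D * J i = J i * X i"
proof (rule eq_matI)
  note [simp] = pd_matD(2,3)[OF X[OF i]]
  fix a k assume "a < dim_row (J i * X i)" "k < dim_col (J i * X i)"
  hence ak: "a < n" "k < r i" by auto
  obtain l j where lj: "l < m" "j < r l" "a = pair_index r (l, j)"
    using ak(1) pair_index_surj[of a r m] unfolding dim by blast
  have "(D * J i) $$ (a, k) = (if l = i then X i $$ (j, k) else 0)"
    using ak lj i pd_matD(1)[OF X] by (subst mult_block_embed_index) (auto simp: diag_block_mat_index)
  moreover have "(J i * X i) $$ (a, k) = (\<Sum>t<r i. if t = j then (if l = i then X i $$ (j, k) else 0) else 0)"
    using ak lj i by (subst mat_mult_index_sum)
      (auto simp: block_embed_def dim pair_index_eq_iff[of _ m] simp del: sum.delta sum.delta' intro!: sum.cong)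
  ultimately show "(D * J i) $$ (a, k) = (J i * X i) $$ (a, k)" using lj by auto
qed (use pd_matD(3)[OF X[OF i]] in auto)

lemma diag_block_mat_hermitian: "D\<^sup>\<dagger> = D"
proof (rule eq_matI)
  fix a b assume "a < dim_row D" "b < dim_col D"
  hence ab: "a < n" "b < n" by auto
  obtain i j where ij: "i < m" "j < r i" "a = pair_index r (i, j)" using ab(1) pair_index_surj[of a r m] unfolding dim by blast
  obtain k l where kl: "k < m" "l < r k" "b = pair_index r (k, l)" using ab(2) pair_index_surj[of b r m] unfolding dim by blast
  have "cnj (X i $$ (l, j)) = X i $$ (j, l)" if "i = k"
  proof -
    have "cnj (X i $$ (l, j)) = (X i)\<^sup>\<dagger> $$ (j, l)"
      using pd_matD(2,3)[OF X[OF ij(1)]] ij kl that by (subst mat_adjoint_index) auto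
    thus ?thesis by (simp only: pd_matD(4)[OF X[OF ij(1)]])
  qed
  thus "D\<^sup>\<dagger> $$ (a, b) = D $$ (a, b)"
    using ab ij kl pd_matD(1)[OF X] by (auto simp: diag_block_mat_index)
qed auto

lemma adjoint_embed_mult_diag_block_mat:
  assumes i: "i < m"
  shows "(J i)\<^sup>\<dagger> * D = X i * (J i)\<^sup>\<dagger>"
  using arg_cong[OF diag_block_mat_mult_embed[OF i], of mat_adjoint] pd_matD(2-4)[OF X[OF i]]
  by (simp add: mat_adjoint_mult diag_block_mat_hermitian)

lemma diag_block_mat_kernel:
  assumes v: "v \<in> carrier_vec n" and z: "D *\<^sub>v v = 0\<^sub>v n"
  shows "v = 0\<^sub>v n"
proof (rule vec_zero_blockwise[OF v])
  fix i assume i: "i < m"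
  note [simp] = pd_matD(2,3)[OF X[OF i]]
  have "X i *\<^sub>v ((J i)\<^sup>\<dagger> *\<^sub>v v) = (J i)\<^sup>\<dagger> *\<^sub>v (D *\<^sub>v v)"
    using v by (simp add: adjoint_embed_mult_diag_block_mat[OF i] flip: mat_assoc_vec_dim)
  also have "\<dots> = 0\<^sub>v (r i)" unfolding z by (simp add: mat_mult_zero_vec)
  finally show "(J i)\<^sup>\<dagger> *\<^sub>v v = 0\<^sub>v (r i)"
    by (rule pd_mat_kernel[OF X[OF i], rotated]) (auto intro!: carrier_vecI)
qed

lemma diag_block_mat_inverse:
  shows "mat_inv D \<in> carrier_mat n n" "D * mat_inv D = 1\<^sub>m n" "mat_inv D * D = 1\<^sub>m n"
  using mat_inv_inverse[OF diag_block_mat_carrier] diag_block_mat_kernel by blast+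

lemma diag_block_mat_commute_proj:
  assumes i: "i < m"
  shows "J i * (J i)\<^sup>\<dagger> * D = D * (J i * (J i)\<^sup>\<dagger>)"
  using pd_matD(2,3)[OF X[OF i]]
    mat_assoc_cong[OF diag_block_mat_mult_embed[OF i], of "(J i)\<^sup>\<dagger>"]
  by (simp add: mat_assoc_dim adjoint_embed_mult_diag_block_mat[OF i])

text \<open>The block equation is carried to the whole space by \<open>J\<close> on the left and
  \<open>J\<^sup>\<dagger>\<close> on the right, and recovered by the opposite factors because
  \<open>J\<^sup>\<dagger> J = 1\<close>; \<open>D\<close> acts on block \<open>i\<close> as
  \<open>X i\<close>. The condition on \<open>S\<close> is thereby expressed through
  \<open>D\<close> and a projection alone.\<close>

lemma diag_block_eq_square_iff:
  assumes S: "S \<in> carrier_mat n n" and i: "i < m"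
  shows "diag_block r S i = X i * X i \<longleftrightarrow>
    (J i * (J i)\<^sup>\<dagger>) * (S * (J i * (J i)\<^sup>\<dagger>)) = D * (D * (J i * (J i)\<^sup>\<dagger>))"
    (is "?l \<longleftrightarrow> ?r")
proof -
  note [simp] = pd_matD(2,3)[OF X[OF i]]
  have [simp]: "dim_row S = n" "dim_col S = n" using S by auto
  have DJ: "D * J i = J i * X i" by (rule diag_block_mat_mult_embed[OF i])
  have DDJ: "D * (D * (J i * Z)) = J i * (X i * (X i * Z))" if "dim_row Z = r i" for Z
    using that mat_assoc_cong[OF DJ, of Z] mat_assoc_cong[OF DJ, of "X i * Z"] by (simp add: mat_assoc_dim)
  have JJ: "(J i)\<^sup>\<dagger> * J i = 1\<^sub>m (r i)" using block_embed_adjoint_mult[OF i i] by simp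
  have JJZ: "(J i)\<^sup>\<dagger> * (J i * Z) = Z" if "dim_row Z = r i" for Z
    using that mat_assoc_cong[OF JJ, of Z] by simp
  show ?thesis
  proof
    assume ?l
    hence "(J i)\<^sup>\<dagger> * (S * J i) = X i * X i" by (simp add: diag_block_eq[OF S i])
    hence "(J i)\<^sup>\<dagger> * (S * J i) * (J i)\<^sup>\<dagger> = X i * X i * (J i)\<^sup>\<dagger>" by simp
    hence "(J i)\<^sup>\<dagger> * (S * (J i * (J i)\<^sup>\<dagger>)) = X i * (X i * (J i)\<^sup>\<dagger>)"
      by (simp add: mat_assoc_dim)
    thus ?r by (simp add: mat_assoc_dim DDJ)
  next
    assume ?r
    hence "(J i)\<^sup>\<dagger> * ((J i * (J i)\<^sup>\<dagger>) * (S * (J i * (J i)\<^sup>\<dagger>))) * J i = (J i)\<^sup>\<dagger> * (D * (D * (J i * (J i)\<^sup>\<dagger>))) * J i"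
      by simp
    hence "(J i)\<^sup>\<dagger> * (S * J i) = X i * X i"
      by (simp add: mat_assoc_dim DDJ JJZ JJ)
    thus ?l by (simp add: diag_block_eq[OF S i])
  qed
qed

end

section \<open>Families of vectors as columns of a matrix\<close>

lemma pair_cols_dim [simp]: "dim_row (pair_cols n m r v) = n" "dim_col (pair_cols n m r v) = n"
  by (auto simp: pair_cols_def dim)

lemma col_pair_cols:
  assumes "i < m" "j < r i" "v i j \<in> carrier_vec n"
  shows "col (pair_cols n m r v) (pair_index r (i, j)) = v i j"
  using assms pair_index_less[of i m j r] pairs_nth_pair_index(2)[of i m j r]
  by (intro eq_vecI) (auto simp: pair_cols_def dim)

lemma pair_cols_adjoint_mult_index:
  assumes "i < m" "j < r i" "k < m" "l < r k"
    "v i j \<in> carrier_vec n" "w k l \<in> carrier_vec n"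
  shows "((pair_cols n m r v)\<^sup>\<dagger> * pair_cols n m r w) $$ (pair_index r (i, j), pair_index r (k, l)) =
    braket (v i j) (w k l)"
  using assms pair_index_less[of i m j r] pair_index_less[of k m l r] dim
  by (subst adjoint_mult_index) (auto simp: col_pair_cols)

lemma pair_mat_eqI:
  assumes "dim_row A = n" "dim_col A = n" "dim_row B = n" "dim_col B = n"
    "\<And>i j k l. i < m \<Longrightarrow> j < r i \<Longrightarrow> k < m \<Longrightarrow> l < r k \<Longrightarrow>
      A $$ (pair_index r (i, j), pair_index r (k, l)) = B $$ (pair_index r (i, j), pair_index r (k, l))"
  shows "A = B"
proof (rule eq_matI)
  fix a b assume "a < dim_row B" "b < dim_col B"
  hence "a < (\<Sum>i<m. r i)" "b < (\<Sum>i<m. r i)" using assms dim by auto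
  thus "A $$ (a, b) = B $$ (a, b)" using assms(5) pair_index_surj by metis
qed (use assms in auto)

lemma gram_mat_eq:
  assumes "\<And>i j. i < m \<Longrightarrow> j < r i \<Longrightarrow> v i j \<in> carrier_vec n"
  shows "gram_mat m r v = (pair_cols n m r v)\<^sup>\<dagger> * pair_cols n m r v"
  using assms pairs_nth_pair_index pair_index_less[of _ m _ r, unfolded dim]
  by (intro pair_mat_eqI)
    (auto simp: gram_mat_def pair_mat_def length_pairs dim pair_cols_adjoint_mult_index
      simp del: index_mult_mat(1))

lemma sum_ketbra_cols:
  fixes C :: "complex mat"
  assumes "C \<in> carrier_mat n k"
  shows "mat_sum n (\<lambda>j. ketbra (col C j) (col C j)) {..<k} = C * C\<^sup>\<dagger>"
  by (rule mat_sum_eqI[symmetric])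
    (use assms in \<open>auto simp: ketbra_def mat_mult_index_sum simp del: index_mult_mat(1)\<close>)

text \<open>Serves both expansions into rank-one operators: that of the weighted state, with
  \<open>W = \<Psi>\<close>, and that of the measurement operator, with
  \<open>W = U D\<^sup>-\<^sup>1 S\<close>.\<close>

lemma sum_ketbra_block:
  assumes W: "W \<in> carrier_mat n n" and i: "i < m"
    and w: "\<And>j. j < r i \<Longrightarrow> w j = col W (pair_index r (i, j))"
  shows "mat_sum n (\<lambda>j. ketbra (w j) (w j)) {..<r i} = W * (J i * (J i)\<^sup>\<dagger>) * W\<^sup>\<dagger>"
proof -
  have [simp]: "dim_row W = n" "dim_col W = n" using W by auto
  have "mat_sum n (\<lambda>j. ketbra (w j) (w j)) {..<r i} =
      mat_sum n (\<lambda>j. ketbra (col (W * J i) j) (col (W * J i) j)) {..<r i}"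
    using w col_mult_block_embed[OF W i]
    by (intro mat_sum_cong) (auto intro!: carrier_matI simp del: col_mult2)
  also have "\<dots> = (W * J i) * (W * J i)\<^sup>\<dagger>" by (intro sum_ketbra_cols) (auto intro!: carrier_matI)
  finally show ?thesis by (simp add: mat_adjoint_mult mat_assoc_dim)
qed

text \<open>Identifies the double sum which defines each vector \<open>w i j\<close> as a column of
  one matrix product, so that \<open>sum_ketbra_block\<close> becomes applicable.\<close>

lemma sum_smult_pair_cols:
  assumes u: "\<And>i j. i < m \<Longrightarrow> j < r i \<Longrightarrow> u i j \<in> carrier_vec n"
    and A: "A \<in> carrier_mat n n" and c: "c < n"
  shows "vec_sum n (\<lambda>l. vec_sum n (\<lambda>k. A $$ (pair_index r (l, k), c) \<cdot>\<^sub>v u l k) {..<r l}) {..<m} =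
    col (pair_cols n m r u * A) c"
proof (rule eq_vecI)
  have [simp]: "dim_row A = n" "dim_col A = n" using A by auto
  have inner: "vec_sum n (\<lambda>k. A $$ (pair_index r (l, k), c) \<cdot>\<^sub>v u l k) {..<r l} \<in> carrier_vec n"
    if "l < m" for l
    using u that by (intro finsum_vec_closed) auto
  have "vec_sum n (\<lambda>l. vec_sum n (\<lambda>k. A $$ (pair_index r (l, k), c) \<cdot>\<^sub>v u l k) {..<r l}) {..<m} \<in> carrier_vec n"
    using inner by (intro finsum_vec_closed) auto
  thus "dim_vec (vec_sum n (\<lambda>l. vec_sum n (\<lambda>k. A $$ (pair_index r (l, k), c) \<cdot>\<^sub>v u l k) {..<r l}) {..<m}) =
      dim_vec (col (pair_cols n m r u * A) c)" by auto
  fix a assume "a < dim_vec (col (pair_cols n m r u * A) c)"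
  hence a: "a < n" by simp
  have "vec_sum n (\<lambda>l. vec_sum n (\<lambda>k. A $$ (pair_index r (l, k), c) \<cdot>\<^sub>v u l k) {..<r l}) {..<m} $ a =
      (\<Sum>l<m. vec_sum n (\<lambda>k. A $$ (pair_index r (l, k), c) \<cdot>\<^sub>v u l k) {..<r l} $ a)"
    using inner a by (intro index_finsum_vec) auto
  also have "\<dots> = (\<Sum>l<m. \<Sum>k<r l. A $$ (pair_index r (l, k), c) * u l k $ a)"
  proof (intro sum.cong refl)
    fix l assume "l \<in> {..<m}"
    thus "vec_sum n (\<lambda>k. A $$ (pair_index r (l, k), c) \<cdot>\<^sub>v u l k) {..<r l} $ a =
        (\<Sum>k<r l. A $$ (pair_index r (l, k), c) * u l k $ a)"
      using u a by (subst index_finsum_vec) (auto intro!: sum.cong, metis carrier_vecD index_smult_vec(1))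
  qed
  also have "\<dots> = (\<Sum>l<m. \<Sum>k<r l. A $$ (pair_index r (l, k), c) * pair_cols n m r u $$ (a, pair_index r (l, k)))"
    using a pairs_nth_pair_index pair_index_less dim
    by (intro sum.cong refl) (auto simp: pair_cols_def)
  also have "\<dots> = (\<Sum>d<n. A $$ (d, c) * pair_cols n m r u $$ (a, d))"
    unfolding dim[symmetric] by (rule sum_pair_index[symmetric])
  also have "\<dots> = (pair_cols n m r u * A) $$ (a, c)"
    using a c by (subst mat_mult_index_sum) (auto simp: mult.commute)
  finally show "vec_sum n (\<lambda>l. vec_sum n (\<lambda>k. A $$ (pair_index r (l, k), c) \<cdot>\<^sub>v u l k) {..<r l}) {..<m} $ a =
      col (pair_cols n m r u * A) c $ a" using a c by simp
qed

end

subsection \<open>Passing between the measurement and the block diagonal matrix\<close>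

text \<open>In both lemmas below the columns of \<open>\<Psi>\<close> are the vectors of the decomposition, those of \<open>U\<close> the
  dual basis, \<open>P\<close> is the projection onto one block, and \<open>K\<close> is the operator of the optimality criterion;
  the two are related by \<open>K = W * S * W\<^sup>\<dagger>\<close>.\<close>

lemma criterion_of_block_diagonal:
  fixes \<Psi> U D Di S W :: "complex mat"
  assumes dims [simp]: "dim_row \<Psi> = n" "dim_col \<Psi> = n" "dim_row U = n" "dim_col U = n"
      "dim_row D = n" "dim_col D = n" "dim_row Di = n" "dim_col Di = n"
    and dual: "\<Psi>\<^sup>\<dagger> * U = 1\<^sub>m n"
    and D: "D\<^sup>\<dagger> = D" and Di: "D * Di = 1\<^sub>m n" "Di * D = 1\<^sub>m n"
    and S: "psd_mat n S" and SS: "S * S = D * (\<Psi>\<^sup>\<dagger> * \<Psi>) * D"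
  defines "W \<equiv> U * (Di * S)"
  defines "K \<equiv> \<Psi> * D * W\<^sup>\<dagger>"
  shows "K \<in> carrier_mat n n"
    and "\<And>P. P \<in> carrier_mat n n \<Longrightarrow> P\<^sup>\<dagger> = P \<Longrightarrow> P * D = D * P \<Longrightarrow> P * (S * P) = D * (D * P) \<Longrightarrow>
      psd_mat n (K - \<Psi> * P * \<Psi>\<^sup>\<dagger>) \<and> K * (W * P * W\<^sup>\<dagger>) = \<Psi> * P * \<Psi>\<^sup>\<dagger> * (W * P * W\<^sup>\<dagger>)"
proof -
  note [simp] = psd_matD(2-4)[OF S] D
  have [simp]: "dim_row W = n" "dim_col W = n" by (auto simp: W_def)
  have Dih: "Di\<^sup>\<dagger> = Di"
  proof -
    have "Di\<^sup>\<dagger> * D = 1\<^sub>m n" using arg_cong[OF Di(1), of mat_adjoint] by (simp add: mat_adjoint_mult)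
    hence "Di\<^sup>\<dagger> * D * Di = Di" by (simp add: carrier_matI[of Di n n])
    thus ?thesis by (simp add: mat_assoc_dim Di carrier_matI[of "Di\<^sup>\<dagger>" n n])
  qed
  have UPsi: "U * \<Psi>\<^sup>\<dagger> = 1\<^sub>m n" by (rule mat_left_inverse_imp_right_inverse[OF dual]) auto
  have dual': "U\<^sup>\<dagger> * \<Psi> = 1\<^sub>m n" using arg_cong[OF dual, of mat_adjoint] by (simp add: mat_adjoint_mult)
  have PsiU: "\<Psi> * U\<^sup>\<dagger> = 1\<^sub>m n" by (rule mat_left_inverse_imp_right_inverse[OF dual']) auto
  have one: "1\<^sub>m n * Z = Z" if "dim_row Z = n" for Z :: "complex mat"
    using that by simp
  note inv = dual UPsi dual' PsiU Di
  note invZ = inv[THEN mat_assoc_cong]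
  have SSZ: "S * (S * Z) = D * (\<Psi>\<^sup>\<dagger> * (\<Psi> * (D * Z)))" if "dim_row Z = n" for Z
    using that mat_assoc_cong[OF SS, of Z] by (simp add: mat_assoc_dim)
  have Wh: "W\<^sup>\<dagger> = S * (Di * U\<^sup>\<dagger>)" by (simp add: W_def mat_adjoint_mult mat_assoc_dim Dih)
  \<comment> \<open>The two factors \<open>S\<close> meet in this product; once \<open>S * S\<close>
    is replaced, everything cancels in pairs of inverses.\<close>
  have "W * W\<^sup>\<dagger> = 1\<^sub>m n"
    unfolding Wh by (simp add: W_def mat_assoc_dim SSZ invZ one inv)
  hence WW: "W * W\<^sup>\<dagger> = 1\<^sub>m n" "W\<^sup>\<dagger> * W = 1\<^sub>m n"
    using mat_left_inverse_imp_right_inverse[of W "W\<^sup>\<dagger>" n] by auto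
  have WPsiD: "W\<^sup>\<dagger> * (\<Psi> * D) = S"
    unfolding Wh by (simp add: mat_assoc_dim invZ one inv carrier_matI[of S n n])
  \<comment> \<open>The polar decomposition of \<open>\<Psi> * D\<close>; together with its adjoint
    \<open>SW\<close> it removes \<open>S\<close> from the products below.\<close>
  have WS: "W * S = \<Psi> * D"
    unfolding WPsiD[symmetric] using WW by (simp add: invZ one mat_assoc_cong[of W "W\<^sup>\<dagger>"])
  have SW: "S * W\<^sup>\<dagger> = D * \<Psi>\<^sup>\<dagger>"
    using arg_cong[OF WS, of mat_adjoint] by (simp add: mat_adjoint_mult)
  have K: "K = W * S * W\<^sup>\<dagger>" by (simp add: K_def WS)
  show "K \<in> carrier_mat n n" by (auto simp: K_def intro!: carrier_matI)
  fix P assume P: "P \<in> carrier_mat n n" "P\<^sup>\<dagger> = P" and PD: "P * D = D * P" and PSP: "P * (S * P) = D * (D * P)"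
  have [simp]: "dim_row P = n" "dim_col P = n" using P by auto
  have PDi: "P * Di = Di * P"
  proof -
    have "Di * (P * D) * Di = Di * (D * P) * Di" by (simp add: PD)
    thus ?thesis by (simp add: mat_assoc_dim invZ inv one carrier_matI[of P n n])
  qed
  have PDiZ: "P * (Di * Z) = Di * (P * Z)" if "dim_row Z = n" for Z
    using that mat_assoc_cong[OF PDi, of Z] by (simp add: mat_assoc_dim)
  have PSPZ: "P * (S * (P * Z)) = D * (D * (P * Z))" if "dim_row Z = n" for Z
    using that mat_assoc_cong[of P "S * P" _ Z] PSP by (simp add: mat_assoc_dim)
  have "K * (W * P * W\<^sup>\<dagger>) = \<Psi> * (D * (P * W\<^sup>\<dagger>))"
    using WW by (simp add: K_def mat_assoc_dim one mat_assoc_cong[of "W\<^sup>\<dagger>" W])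
  moreover have "\<Psi> * P * \<Psi>\<^sup>\<dagger> * (W * P * W\<^sup>\<dagger>) = \<Psi> * (P * (Di * (S * (P * W\<^sup>\<dagger>))))"
    by (simp add: mat_assoc_dim invZ one W_def)
  \<comment> \<open>The block condition enters here: \<open>P\<close> moves past \<open>Di\<close>,
    the inner \<open>P S P\<close> becomes \<open>D\<^sup>2 P\<close>, and \<open>Di\<close> cancels
    one factor \<open>D\<close>.\<close>
  moreover have "P * (Di * (S * (P * W\<^sup>\<dagger>))) = D * (P * W\<^sup>\<dagger>)"
    by (simp add: PDiZ PSPZ invZ one)
  ultimately have eq: "K * (W * P * W\<^sup>\<dagger>) = \<Psi> * P * \<Psi>\<^sup>\<dagger> * (W * P * W\<^sup>\<dagger>)" by simp
  \<comment> \<open>\<open>Y\<close> makes \<open>z \<mapsto> z - Y z\<close> the minimizer of the \<open>S\<close>-form along the block, so that \<open>K - \<Psi> P \<Psi>\<^sup>\<dagger>\<close> is the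
    congruence of \<open>S\<close> by \<open>L W\<^sup>\<dagger>\<close>: a Schur complement.\<close>
  define Y where "Y = Di * (Di * (P * S))"
  define L where "L = 1\<^sub>m n - Y"
  have [simp]: "dim_row Y = n" "dim_col Y = n" "dim_row L = n" "dim_col L = n" by (auto simp: Y_def L_def)
  have Yh: "Y\<^sup>\<dagger> * Z = S * (Di * (Di * (P * Z)))" if "dim_row Z = n" for Z
    using that by (simp add: Y_def mat_adjoint_mult mat_assoc_dim P(2) Dih PDiZ)
  \<comment> \<open>\<open>S * Y\<close> equals both \<open>Y\<^sup>\<dagger> S\<close> and
    \<open>Y\<^sup>\<dagger> S Y\<close>: \<open>Y\<close> acts as an orthogonal projection for the
    form of \<open>S\<close>, and the cross terms of \<open>L\<^sup>\<dagger> S L\<close>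
    collapse.\<close>
  have "Y\<^sup>\<dagger> * S = S * Y" by (simp add: Yh) (simp add: Y_def)
  moreover have "Y\<^sup>\<dagger> * (S * Y) = S * Y"
    by (simp add: Yh) (simp add: Y_def PDiZ[symmetric] mat_assoc_dim PSPZ invZ one)
  ultimately have LSL: "L\<^sup>\<dagger> * (S * L) = S - S * Y"
    by (simp add: L_def mat_adjoint_diff mat_distrib_dim) (auto intro!: eq_matI)
  \<comment> \<open>Replacing \<open>W * S\<close> by \<open>\<Psi> * D\<close> and
    \<open>S * W\<^sup>\<dagger>\<close> by \<open>D * \<Psi>\<^sup>\<dagger>\<close> shows that
    what is subtracted is exactly the weighted state: \<open>P\<close> commutes with
    \<open>D\<close>, so the factors \<open>D\<close> and \<open>Di\<close> cancel.\<close>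
  have "W * (S * Y) * W\<^sup>\<dagger> = W * S * Di * Di * P * (S * W\<^sup>\<dagger>)"
    by (simp add: Y_def mat_assoc_dim)
  also have "\<dots> = \<Psi> * (D * (Di * (Di * (P * (D * \<Psi>\<^sup>\<dagger>)))))"
    unfolding WS SW by (simp add: mat_assoc_dim)
  also have "\<dots> = \<Psi> * P * \<Psi>\<^sup>\<dagger>"
    using mat_assoc_cong[OF PD, of "\<Psi>\<^sup>\<dagger>"] by (simp add: mat_assoc_dim invZ one)
  finally have "K - \<Psi> * P * \<Psi>\<^sup>\<dagger> = W * (S - S * Y) * W\<^sup>\<dagger>"
    by (simp add: K mat_distrib_dim)
  also have "\<dots> = (L * W\<^sup>\<dagger>)\<^sup>\<dagger> * S * (L * W\<^sup>\<dagger>)"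
    by (simp add: mat_adjoint_mult mat_assoc_dim flip: LSL)
  finally have "psd_mat n (K - \<Psi> * P * \<Psi>\<^sup>\<dagger>)"
    using psd_mat_congruence[OF S, of "L * W\<^sup>\<dagger>" n] by (simp add: carrier_matI)
  with eq show "psd_mat n (K - \<Psi> * P * \<Psi>\<^sup>\<dagger>) \<and> K * (W * P * W\<^sup>\<dagger>) = \<Psi> * P * \<Psi>\<^sup>\<dagger> * (W * P * W\<^sup>\<dagger>)" by blast
qed

lemma block_diagonal_of_criterion:
  fixes \<Psi> U D Di K Ki :: "complex mat"
  assumes dims [simp]: "dim_row \<Psi> = n" "dim_col \<Psi> = n" "dim_row U = n" "dim_col U = n"
      "dim_row D = n" "dim_col D = n" "dim_row Di = n" "dim_col Di = n"
      "dim_row Ki = n" "dim_col Ki = n"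
    and dual: "\<Psi>\<^sup>\<dagger> * U = 1\<^sub>m n"
    and D: "D\<^sup>\<dagger> = D" and Di: "Di * D = 1\<^sub>m n"
    and K: "psd_mat n K" and Ki: "K * Ki = 1\<^sub>m n" "Ki * K = 1\<^sub>m n"
    and DD: "D * D = U\<^sup>\<dagger> * K * K * U"
  shows "\<exists>S. psd_mat n S \<and> S * S = D * (\<Psi>\<^sup>\<dagger> * \<Psi>) * D \<and>
    (\<forall>P F. P \<in> carrier_mat n n \<longrightarrow> F \<in> carrier_mat n n \<longrightarrow> P * D = D * P \<longrightarrow>
      K * F = \<Psi> * P * \<Psi>\<^sup>\<dagger> * F \<longrightarrow> U\<^sup>\<dagger> * (K * (F * (K * U))) = P * (D * D) \<longrightarrow>
      F = (U * (Di * S)) * P * (U * (Di * S))\<^sup>\<dagger> \<and> P * (S * P) = D * (D * P))"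
proof -
  note [simp] = psd_matD(2-4)[OF K] D
  have one: "1\<^sub>m n * Z = Z" if "dim_row Z = n" for Z :: "complex mat"
    using that by simp
  have Kih: "Ki\<^sup>\<dagger> = Ki"
  proof -
    have "Ki\<^sup>\<dagger> * K = 1\<^sub>m n" using arg_cong[OF Ki(1), of mat_adjoint] by (simp add: mat_adjoint_mult)
    hence "Ki\<^sup>\<dagger> * K * Ki = Ki" by (simp add: one)
    thus ?thesis by (simp add: mat_assoc_dim Ki carrier_matI[of "Ki\<^sup>\<dagger>" n n])
  qed
  have UPsi: "U * \<Psi>\<^sup>\<dagger> = 1\<^sub>m n" by (rule mat_left_inverse_imp_right_inverse[OF dual]) auto
  have dual': "U\<^sup>\<dagger> * \<Psi> = 1\<^sub>m n" using arg_cong[OF dual, of mat_adjoint] by (simp add: mat_adjoint_mult)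
  have PsiU: "\<Psi> * U\<^sup>\<dagger> = 1\<^sub>m n" by (rule mat_left_inverse_imp_right_inverse[OF dual']) auto
  note inv = dual UPsi dual' PsiU Di Ki
  note invZ = inv[THEN mat_assoc_cong]
  have DDZ: "D * (D * Z) = U\<^sup>\<dagger> * (K * (K * (U * Z)))" if "dim_row Z = n" for Z
    using that mat_assoc_cong[OF DD, of Z] by (simp add: mat_assoc_dim)
  \<comment> \<open>By \<open>DD\<close> the square of \<open>K\<close> is
    \<open>\<Psi> D\<^sup>2 \<Psi>\<^sup>\<dagger>\<close>, so this is the unitary factor in
    \<open>\<Psi> * D = K * W\<close>; conjugation by it moves the positive factor to the other
    side.\<close>
  define W where "W = Ki * (\<Psi> * D)"
  have [simp]: "dim_row W = n" "dim_col W = n" by (auto simp: W_def)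
  have Wh: "W\<^sup>\<dagger> = D * (\<Psi>\<^sup>\<dagger> * Ki)" by (simp add: W_def mat_adjoint_mult mat_assoc_dim Kih)
  have KW: "K * W = \<Psi> * D" by (simp add: W_def invZ one)
  have "W * W\<^sup>\<dagger> = 1\<^sub>m n"
    unfolding Wh by (simp add: W_def mat_assoc_dim DDZ invZ one inv)
  hence WW: "W * W\<^sup>\<dagger> = 1\<^sub>m n" "W\<^sup>\<dagger> * W = 1\<^sub>m n"
    using mat_left_inverse_imp_right_inverse[of W "W\<^sup>\<dagger>" n] by auto
  note WWZ = WW[THEN mat_assoc_cong]
  define S where "S = W\<^sup>\<dagger> * K * W"
  have S: "psd_mat n S" unfolding S_def by (rule psd_mat_congruence[OF K]) (auto intro!: carrier_matI)
  note [simp] = psd_matD(2-4)[OF S]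
  have S1: "S = W\<^sup>\<dagger> * (\<Psi> * D)" by (simp add: S_def mat_assoc_dim KW)
  have S2: "S = D * (\<Psi>\<^sup>\<dagger> * W)"
    using arg_cong[OF S1, of mat_adjoint] by (simp add: mat_adjoint_mult mat_assoc_dim)
  have "S * S = D * (\<Psi>\<^sup>\<dagger> * W) * (W\<^sup>\<dagger> * (\<Psi> * D))" using S1 S2 by metis
  hence SS: "S * S = D * (\<Psi>\<^sup>\<dagger> * \<Psi>) * D" by (simp add: mat_assoc_dim WWZ one)
  have W: "U * (Di * S) = W" by (simp add: S2 invZ one)
  show ?thesis
  \<comment> \<open>\<open>S\<close> is fixed before any block is chosen, so this one witness serves
    all outcomes.\<close>
  proof (intro exI[of _ S] conjI allI impI S SS)
    fix P F
    assume "P \<in> carrier_mat n n" "F \<in> carrier_mat n n"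
      and PD: "P * D = D * P" and KF: "K * F = \<Psi> * P * \<Psi>\<^sup>\<dagger> * F"
      and PDD: "U\<^sup>\<dagger> * (K * (F * (K * U))) = P * (D * D)"
    then have [simp]: "dim_row P = n" "dim_col P = n" "dim_row F = n" "dim_col F = n" by auto
    have PDZ: "P * (D * Z) = D * (P * Z)" if "dim_row Z = n" for Z
      using that mat_assoc_cong[OF PD, of Z] by (simp add: mat_assoc_dim)
    have PDDZ: "P * (D * (D * Z)) = U\<^sup>\<dagger> * (K * (F * (K * (U * Z))))" if "dim_row Z = n" for Z
      using that arg_cong[OF PDD, of "\<lambda>M. M * Z"] by (simp add: mat_assoc_dim)
    \<comment> \<open>Once \<open>P\<close> stands next to \<open>D * D\<close>, the assumption
      \<open>PDD\<close> brings in \<open>F\<close>, and all outer factors cancel.\<close>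
    have "W * P * W\<^sup>\<dagger> = Ki * (\<Psi> * (P * (D * (D * (\<Psi>\<^sup>\<dagger> * Ki)))))"
      unfolding Wh by (simp add: W_def mat_assoc_dim PDZ)
    also have "\<dots> = F"
      by (simp add: PDDZ invZ one inv carrier_matI[of F n n])
    finally have F: "F = W * P * W\<^sup>\<dagger>" ..
    thus "F = (U * (Di * S)) * P * (U * (Di * S))\<^sup>\<dagger>" by (simp add: W)
    \<comment> \<open>The criterion, multiplied by \<open>W\<close> on the right and
      \<open>U\<^sup>\<dagger>\<close> on the left, reads
      \<open>D P = P \<Psi>\<^sup>\<dagger> W P\<close>. A further \<open>D\<close> on the left
      completes \<open>S = D \<Psi>\<^sup>\<dagger> W\<close> between the two factors
      \<open>P\<close>.\<close>
    have "K * F * W = K * (W * P)" using WW by (simp add: F mat_assoc_dim WWZ one carrier_matI[of P n n])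
    moreover have "\<Psi> * P * \<Psi>\<^sup>\<dagger> * F * W = \<Psi> * P * \<Psi>\<^sup>\<dagger> * (W * P)"
      using WW by (simp add: F mat_assoc_dim carrier_matI[of P n n])
    ultimately have "K * (W * P) = \<Psi> * P * \<Psi>\<^sup>\<dagger> * (W * P)" using KF by simp
    hence "\<Psi> * (D * P) = \<Psi> * (P * (\<Psi>\<^sup>\<dagger> * (W * P)))"
      using mat_assoc_cong[OF KW, of P] by (simp add: mat_assoc_dim)
    hence "U\<^sup>\<dagger> * (\<Psi> * (D * P)) = U\<^sup>\<dagger> * (\<Psi> * (P * (\<Psi>\<^sup>\<dagger> * (W * P))))" by simp
    hence DP: "D * P = P * (\<Psi>\<^sup>\<dagger> * (W * P))" by (simp add: invZ one)
    show "P * (S * P) = D * (D * P)"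
      by (subst S2, subst DP) (simp add: mat_assoc_dim PDZ)
  qed
qed

text \<open>The form of \<open>K\<close> at \<open>v\<close> bounds the squared norm of every block
  of \<open>\<Psi>\<^sup>\<dagger> v\<close>. If it were not positive, all blocks would vanish, and
  \<open>U\<close> would recover \<open>v = 0\<close>.\<close>

lemma pd_mat_of_criterion:
  fixes K :: "complex mat"
  assumes dim: "(\<Sum>i<m. r i) = n" and m: "0 < m"
    and dims [simp]: "dim_row \<Psi> = n" "dim_col \<Psi> = n" "dim_row U = n" "dim_col U = n"
    and K: "K \<in> carrier_mat n n" and UPsi: "U * \<Psi>\<^sup>\<dagger> = 1\<^sub>m n"
    and psd: "\<And>i. i < m \<Longrightarrow>
      psd_mat n (K - \<Psi> * (block_embed m r i * (block_embed m r i)\<^sup>\<dagger>) * \<Psi>\<^sup>\<dagger>)"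
  shows "pd_mat n K"
proof -
  note [simp] = block_embed_dim[OF dim]
  have [simp]: "dim_row K = n" "dim_col K = n" using K by auto
  define B where "B = (\<lambda>i. (block_embed m r i)\<^sup>\<dagger> * \<Psi>\<^sup>\<dagger>)"
  have [simp]: "dim_row (B i) = r i" "dim_col (B i) = n" for i by (auto simp: B_def)
  have R: "\<Psi> * (block_embed m r i * (block_embed m r i)\<^sup>\<dagger>) * \<Psi>\<^sup>\<dagger> = (B i)\<^sup>\<dagger> * B i" for i
    by (simp add: B_def mat_adjoint_mult mat_assoc_dim)
  have psdB: "psd_mat n (K - (B i)\<^sup>\<dagger> * B i)" if "i < m" for i using psd[OF that] by (simp add: R)
  have ge: "Re (braket (B i *\<^sub>v v) (B i *\<^sub>v v)) \<le> Re (braket v (K *\<^sub>v v))"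
    if i: "i < m" and v: "v \<in> carrier_vec n" for i v
  proof -
    have [simp]: "dim_vec v = n" using v by auto
    show ?thesis using psd_matD(5)[OF psdB[OF i] v]
      by (simp add: braket_diff_mat braket_adjoint_mult_self)
  qed
  have "0 < Re (braket v (K *\<^sub>v v))" if v: "v \<in> carrier_vec n" "v \<noteq> 0\<^sub>v n" for v
  proof (rule ccontr)
    assume le: "\<not> ?thesis"
    have [simp]: "dim_vec v = n" using v by auto
    have "\<Psi>\<^sup>\<dagger> *\<^sub>v v = 0\<^sub>v n"
    proof (rule vec_zero_blockwise[OF dim])
      show "\<Psi>\<^sup>\<dagger> *\<^sub>v v \<in> carrier_vec n" by (auto intro!: carrier_vecI)
      fix i assume i: "i < m"
      have "Re (braket (B i *\<^sub>v v) (B i *\<^sub>v v)) = 0"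
        using ge[OF i v(1)] le braket_self_nonneg[of "B i *\<^sub>v v"] by linarith
      hence "B i *\<^sub>v v = 0\<^sub>v (r i)" using braket_self_eq_0[of "B i *\<^sub>v v"] by simp
      thus "(block_embed m r i)\<^sup>\<dagger> *\<^sub>v (\<Psi>\<^sup>\<dagger> *\<^sub>v v) = 0\<^sub>v (r i)"
        by (simp add: B_def mat_assoc_vec_dim)
    qed
    hence "U *\<^sub>v (\<Psi>\<^sup>\<dagger> *\<^sub>v v) = 0\<^sub>v n" by (simp add: mat_mult_zero_vec)
    hence "U * \<Psi>\<^sup>\<dagger> *\<^sub>v v = 0\<^sub>v n" by (simp add: mat_assoc_vec_dim)
    thus False using v by (simp add: UPsi)
  qed
  \<comment> \<open>Real parts of the form do not reveal that \<open>K\<close> is Hermitian; this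
    sum of two positive semidefinite matrices does, and it uses that outcome 0 exists.\<close>
  moreover have "K = (K - (B 0)\<^sup>\<dagger> * B 0) + (B 0)\<^sup>\<dagger> * B 0" by (intro eq_matI) auto
  hence "psd_mat n K"
    using psd_mat_add[OF psdB[OF m] psd_mat_adjoint_mult_self[of "B 0" "r 0" n]]
    by (metis carrier_matI \<open>\<And>i. dim_col (B i) = n\<close> \<open>\<And>i. dim_row (B i) = r i\<close>)
  ultimately show ?thesis by (auto simp: pd_mat_def psd_mat_def)
qed

text \<open>\<open>C J\<close> has the left inverse \<open>J\<^sup>\<dagger> B\<close>, hence is
  injective. Applied with \<open>C = K U\<close> it makes the diagonal blocks of
  \<open>U\<^sup>\<dagger> K\<^sup>2 U\<close> positive definite.\<close>

lemma pd_mat_compression: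
  fixes C :: "complex mat"
  assumes dim: "(\<Sum>i<m. r i) = n" and i: "i < m"
    and C: "C \<in> carrier_mat n n" and inv: "B * C = 1\<^sub>m n" "B \<in> carrier_mat n n"
  shows "pd_mat (r i) ((block_embed m r i)\<^sup>\<dagger> * (C\<^sup>\<dagger> * C * block_embed m r i))"
proof -
  let ?J = "block_embed m r i"
  note [simp] = block_embed_dim[OF dim]
  have [simp]: "dim_row C = n" "dim_col C = n" "dim_row B = n" "dim_col B = n" using C inv by auto
  have left: "?J\<^sup>\<dagger> * B * (C * ?J) = 1\<^sub>m (r i)"
    using block_embed_adjoint_mult[OF dim i i] mat_assoc_cong[OF inv(1), of ?J]
    by (simp add: mat_assoc_dim carrier_matI[of ?J n "r i"])
  have "pd_mat (r i) ((C * ?J)\<^sup>\<dagger> * (C * ?J))"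
  proof (rule pd_mat_adjoint_mult_self[where k = n])
    fix v assume v: "v \<in> carrier_vec (r i)" and z: "C * ?J *\<^sub>v v = 0\<^sub>v n"
    have "v = ?J\<^sup>\<dagger> * B * (C * ?J) *\<^sub>v v" using v by (simp add: left)
    also have "\<dots> = ?J\<^sup>\<dagger> * B *\<^sub>v (C * ?J *\<^sub>v v)" using v by (intro mat_assoc_vec_dim) auto
    also have "\<dots> = 0\<^sub>v (r i)" by (simp add: z mat_mult_zero_vec)
    finally show "v = 0\<^sub>v (r i)" .
  qed (auto intro!: carrier_matI)
  thus ?thesis by (simp add: mat_adjoint_mult mat_assoc_dim)
qed

section \<open>The equivalence for ensembles, in matrix form\<close>

theorem mainTheorem4:
  fixes n m :: nat and r :: "nat \<Rightarrow> nat" and p :: "nat \<Rightarrow> real"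
    and \<rho> E :: "nat \<Rightarrow> complex mat" and \<psi> u :: "nat \<Rightarrow> nat \<Rightarrow> complex vec"
  assumes ensemble: "lin_indep_ensemble n m p \<rho>"
    and rank: "\<And>i. i < m \<Longrightarrow> vec_space.rank n (\<rho> i) = r i"
    and dim: "(\<Sum>i<m. r i) = n"
    and psi_carrier: "\<And>i j. i < m \<Longrightarrow> j < r i \<Longrightarrow> \<psi> i j \<in> carrier_vec n"
    and decomposition: "\<And>i. i < m \<Longrightarrow>
      complex_of_real (p i) \<cdot>\<^sub>m \<rho> i = mat_sum n (\<lambda>j. ketbra (\<psi> i j) (\<psi> i j)) {..<r i}"
    and u_carrier: "\<And>i j. i < m \<Longrightarrow> j < r i \<Longrightarrow> u i j \<in> carrier_vec n"
    and dual: "\<And>i1 j1 i2 j2. i1 < m \<Longrightarrow> j1 < r i1 \<Longrightarrow> i2 < m \<Longrightarrow> j2 < r i2 \<Longrightarrow>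
      braket (\<psi> i1 j1) (u i2 j2) = (if i1 = i2 \<and> j1 = j2 then 1 else 0)"
    and povm: "is_povm n m E"
  shows "med_optimal n m p \<rho> E \<longleftrightarrow>
    (\<exists>X :: nat \<Rightarrow> complex mat.
      (\<forall>i<m. pd_mat (r i) (X i)) \<and>
      (let D = diag_block_mat (map X [0..<m]);
           S = mat_sqrt (D * gram_mat m r \<psi> * D);
           w = (\<lambda>i j. vec_sum n (\<lambda>l. vec_sum n (\<lambda>k.
                 pair_entry r (mat_inv D * S) (l, k) (i, j) \<cdot>\<^sub>v u l k) {..<r l}) {..<m})
       in (\<forall>i<m. diag_block r S i = X i * X i) \<and>
          (\<forall>i<m. E i = mat_sum n (\<lambda>j. ketbra (w i j) (w i j)) {..<r i})))"
proof -
  define \<Psi> where "\<Psi> = pair_cols n m r \<psi>"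
  define U where "U = pair_cols n m r u"
  define J where "J = block_embed m r"
  define P where "P = (\<lambda>i. J i * (J i)\<^sup>\<dagger>)"
  have [simp]: "dim_row \<Psi> = n" "dim_col \<Psi> = n" "dim_row U = n" "dim_col U = n"
    "dim_row (J i) = n" "dim_col (J i) = r i" "dim_row (P i) = n" "dim_col (P i) = n" for i
    using dim by (auto simp: \<Psi>_def U_def J_def P_def pair_cols_dim block_embed_dim)
  have Ph [simp]: "(P i)\<^sup>\<dagger> = P i" for i by (simp add: P_def mat_adjoint_mult)
  have Pc [simp]: "P i \<in> carrier_mat n n" for i by (auto intro!: carrier_matI)
  have gram: "gram_mat m r \<psi> = \<Psi>\<^sup>\<dagger> * \<Psi>"
    unfolding \<Psi>_def by (rule gram_mat_eq[OF dim psi_carrier])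
  have PsiU: "\<Psi>\<^sup>\<dagger> * U = 1\<^sub>m n"
  proof (rule pair_mat_eqI[OF dim])
    fix i j k l assume "i < m" "j < r i" "k < m" "l < r k"
    thus "(\<Psi>\<^sup>\<dagger> * U) $$ (pair_index r (i, j), pair_index r (k, l)) =
        (1\<^sub>m n :: complex mat) $$ (pair_index r (i, j), pair_index r (k, l))"
      unfolding \<Psi>_def U_def
      using psi_carrier u_carrier dual pair_index_less[of i m j r] pair_index_less[of k m l r]
      by (simp add: pair_cols_adjoint_mult_index[OF dim] dim pair_index_eq_iff[of i m]
          del: index_mult_mat(1))
  qed auto
  have UPsi: "U * \<Psi>\<^sup>\<dagger> = 1\<^sub>m n" by (rule mat_left_inverse_imp_right_inverse[OF PsiU]) auto
  have R: "complex_of_real (p i) \<cdot>\<^sub>m \<rho> i = \<Psi> * P i * \<Psi>\<^sup>\<dagger>" if i: "i < m" for i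
    unfolding decomposition[OF i] P_def J_def
    using i psi_carrier by (intro sum_ketbra_block[OF dim])
      (auto simp: \<Psi>_def col_pair_cols[OF dim] pair_cols_dim[OF dim] intro!: carrier_matI)
  have rho: "hermitian_mat n (\<rho> i)" if "i < m" for i
    using ensemble that by (auto simp: lin_indep_ensemble_def density_operator_def psd_mat_def)
  \<comment> \<open>An empty sum of probabilities would be 0 instead of 1.\<close>
  have m: "0 < m" using ensemble by (auto simp: lin_indep_ensemble_def intro: gr0I)
  have E: "psd_mat n (E i)" if "i < m" for i using povm that by (auto simp: is_povm_def)
  have "(\<exists>K \<in> carrier_mat n n. \<forall>i<m. psd_mat n (K - complex_of_real (p i) \<cdot>\<^sub>m \<rho> i) \<and>
        K * E i = complex_of_real (p i) \<cdot>\<^sub>m \<rho> i * E i) \<longleftrightarrow>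
      (\<exists>K \<in> carrier_mat n n. \<forall>i<m. psd_mat n (K - \<Psi> * P i * \<Psi>\<^sup>\<dagger>) \<and> K * E i = \<Psi> * P i * \<Psi>\<^sup>\<dagger> * E i)"
    by (intro bex_cong refl all_cong) (simp add: R)
  hence opt: "med_optimal n m p \<rho> E \<longleftrightarrow>
      (\<exists>K \<in> carrier_mat n n. \<forall>i<m. psd_mat n (K - \<Psi> * P i * \<Psi>\<^sup>\<dagger>) \<and> K * E i = \<Psi> * P i * \<Psi>\<^sup>\<dagger> * E i)"
    using med_optimal_iff[OF rho povm] by simp
  \<comment> \<open>Shared by both directions. Uniqueness of the positive root lets any positive
    \<open>S\<close> with the right square stand for the \<open>mat_sqrt\<close> of the statement;
    the conditions on blocks and vectors then become equations between \<open>P i\<close>,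
    \<open>S\<close>, \<open>D\<close> and \<open>U\<close>.\<close>
  have translate: "(let D = diag_block_mat (map X [0..<m]);
           S = mat_sqrt (D * gram_mat m r \<psi> * D);
           w = (\<lambda>i j. vec_sum n (\<lambda>l. vec_sum n (\<lambda>k.
                 pair_entry r (mat_inv D * S) (l, k) (i, j) \<cdot>\<^sub>v u l k) {..<r l}) {..<m})
       in (\<forall>i<m. diag_block r S i = X i * X i) \<and>
          (\<forall>i<m. E i = mat_sum n (\<lambda>j. ketbra (w i j) (w i j)) {..<r i})) \<longleftrightarrow>
      (\<forall>i<m. P i * (S * P i) = D * (D * P i) \<and>
        E i = (U * (mat_inv D * S)) * P i * (U * (mat_inv D * S))\<^sup>\<dagger>)"
    if X: "\<And>i. i < m \<Longrightarrow> pd_mat (r i) (X i)" and D: "D = diag_block_mat (map X [0..<m])"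
      and S: "psd_mat n S" "S * S = D * (\<Psi>\<^sup>\<dagger> * \<Psi>) * D" for X D S
  proof -
    have sqrt: "mat_sqrt (D * gram_mat m r \<psi> * D) = S" unfolding gram by (rule mat_sqrt_eqI[OF S])
    have Sc: "S \<in> carrier_mat n n" by (rule psd_matD(1)[OF S(1)])
    have Dic: "mat_inv D \<in> carrier_mat n n" unfolding D by (rule diag_block_mat_inverse(1)[OF dim X])
    define A where "A = mat_inv D * S"
    have A: "A \<in> carrier_mat n n" using Sc Dic by (simp add: A_def)
    have w: "mat_sum n (\<lambda>j. ketbra (w j) (w j)) {..<r i} = (U * A) * P i * (U * A)\<^sup>\<dagger>"
      if i: "i < m" and w: "w = (\<lambda>j. vec_sum n (\<lambda>l. vec_sum n (\<lambda>k.
           pair_entry r A (l, k) (i, j) \<cdot>\<^sub>v u l k) {..<r l}) {..<m})" for i w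
      unfolding P_def J_def
    proof (rule sum_ketbra_block[OF dim _ i])
      show "U * A \<in> carrier_mat n n" using A by (auto intro!: carrier_matI)
      fix j assume "j < r i"
      thus "w j = col (U * A) (pair_index r (i, j))"
        unfolding w pair_entry_def U_def
        using sum_smult_pair_cols[where c = "pair_index r (i, j)", OF dim u_carrier A]
          pair_index_less[of i m j r] dim i by simp
    qed
    have blk: "diag_block r S i = X i * X i \<longleftrightarrow> P i * (S * P i) = D * (D * P i)" if i: "i < m" for i
      unfolding P_def J_def D by (rule diag_block_eq_square_iff[OF dim X Sc i])
    show ?thesis
      unfolding Let_def D[symmetric] sqrt A_def[symmetric]
      using w blk by auto
  qed
  show ?thesis
  proof
    assume "med_optimal n m p \<rho> E"
    then obtain K where K: "K \<in> carrier_mat n n"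
      and psd: "\<And>i. i < m \<Longrightarrow> psd_mat n (K - \<Psi> * P i * \<Psi>\<^sup>\<dagger>)"
      and KE: "\<And>i. i < m \<Longrightarrow> K * E i = \<Psi> * P i * \<Psi>\<^sup>\<dagger> * E i"
      unfolding opt by blast
    have pd: "pd_mat n K"
      using psd unfolding P_def J_def by (intro pd_mat_of_criterion[OF dim m _ _ _ _ K UPsi]) auto
    note [simp] = pd_matD(2-4)[OF pd]
    define Ki where "Ki = mat_inv K"
    have "Ki \<in> carrier_mat n n" and Ki: "K * Ki = 1\<^sub>m n" "Ki * K = 1\<^sub>m n"
      unfolding Ki_def using mat_inv_inverse[OF K] pd_mat_kernel[OF pd] by blast+
    then have [simp]: "dim_row Ki = n" "dim_col Ki = n" by auto
    define M where "M = U\<^sup>\<dagger> * K * K * U"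
    have [simp]: "dim_row M = n" "dim_col M = n" by (auto simp: M_def)
    have Mh: "M\<^sup>\<dagger> = M" by (simp add: M_def mat_adjoint_mult mat_assoc_dim)
    define N where "N = (\<lambda>i. U\<^sup>\<dagger> * (K * (E i * (K * U))))"
    have Nc: "N i \<in> carrier_mat n n" if "i < m" for i
      using psd_matD(2,3)[OF E[OF that]] by (auto simp: N_def intro!: carrier_matI)
    have Nh: "(N i)\<^sup>\<dagger> = N i" if "i < m" for i
      using psd_matD(2-4)[OF E[OF that]] by (simp add: N_def mat_adjoint_mult mat_assoc_dim)
    have Msum: "M = mat_sum n N {..<m}"
    proof -
      have KU: "K * U \<in> carrier_mat n n" "U\<^sup>\<dagger> * K \<in> carrier_mat n n" by (auto intro!: carrier_matI)
      have Ec: "E i \<in> carrier_mat n n" if "i < m" for i by (rule psd_matD(1)[OF E[OF that]])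
      have "M = (U\<^sup>\<dagger> * K) * (mat_sum n E {..<m} * (K * U))"
        using povm by (simp add: is_povm_def M_def mat_assoc_dim)
      also have "mat_sum n E {..<m} * (K * U) = mat_sum n (\<lambda>i. E i * (K * U)) {..<m}"
        using Ec KU by (intro mat_sum_mult_right) auto
      also have "(U\<^sup>\<dagger> * K) * \<dots> = mat_sum n (\<lambda>i. (U\<^sup>\<dagger> * K) * (E i * (K * U))) {..<m}"
        using mult_carrier_mat[OF Ec KU(1)] KU by (intro mat_sum_mult_left) auto
      also have "\<dots> = mat_sum n N {..<m}"
        using Nc psd_matD(2,3)[OF E] by (intro mat_sum_cong) (auto simp: N_def mat_assoc_dim)
      finally show ?thesis .
    qed
    \<comment> \<open>The criterion replaces \<open>K * E i\<close>, and
      \<open>U\<^sup>\<dagger>\<close> cancels the leading \<open>\<Psi>\<close>, which leaves the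
      projection in front.\<close>
    have N: "N i = P i * (\<Psi>\<^sup>\<dagger> * (E i * (K * U)))" if i: "i < m" for i
    proof -
      note [simp] = psd_matD(2,3)[OF E[OF i]]
      have "U\<^sup>\<dagger> * \<Psi> = 1\<^sub>m n" using arg_cong[OF PsiU, of mat_adjoint] by (simp add: mat_adjoint_mult)
      moreover have "N i = U\<^sup>\<dagger> * (K * E i * (K * U))" by (simp add: N_def mat_assoc_dim)
      ultimately show ?thesis
        using mat_assoc_cong[of "U\<^sup>\<dagger>" \<Psi> "1\<^sub>m n" "P i * (\<Psi>\<^sup>\<dagger> * (E i * (K * U)))"]
        by (simp add: KE[OF i] mat_assoc_dim)
    qed
    have PP: "P i * P k = (if i = k then P i else 0\<^sub>m n n)" if "i < m" "k < m" for i k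
    proof -
      have "P i * P k = J i * ((J i)\<^sup>\<dagger> * J k * (J k)\<^sup>\<dagger>)" by (simp add: P_def mat_assoc_dim)
      also have "(J i)\<^sup>\<dagger> * J k = (if i = k then 1\<^sub>m (r i) else 0\<^sub>m (r i) (r k))"
        unfolding J_def by (rule block_embed_adjoint_mult[OF dim that])
      finally show ?thesis
        by (auto simp: P_def carrier_matI[of "(J k)\<^sup>\<dagger>" "r k" n] carrier_matI[of "J i" n "r i"])
    qed
    have PN: "P i * N k = (if i = k then N i else 0\<^sub>m n n)" if "i < m" "k < m" for i k
    proof -
      note [simp] = psd_matD(2,3)[OF E[OF that(2)]]
      have "P i * N k = P i * P k * (\<Psi>\<^sup>\<dagger> * (E k * (K * U)))"
        unfolding N[OF that(2)] by (simp add: mat_assoc_dim)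
      thus ?thesis using PP[OF that] N[OF that(2)]
        by (auto simp: left_mult_zero_mat[of _ n n] carrier_matI)
    qed
    have PM: "P i * M = N i" if i: "i < m" for i
    proof -
      have "P i * M = mat_sum n (\<lambda>k. P i * N k) {..<m}"
        unfolding Msum using Nc by (intro mat_sum_mult_left) auto
      also have "\<dots> = N i"
      proof (rule mat_sum_eqI[symmetric])
        fix a b assume "a < n" "b < n"
        thus "N i $$ (a, b) = (\<Sum>k<m. (P i * N k) $$ (a, b))"
          using PN[OF i] i by (simp add: if_distrib[of "\<lambda>M. M $$ (a, b)"] del: index_mult_mat(1) cong: if_cong)
      qed (use Nc[OF i] PN[OF i] Nc in auto)
      finally show ?thesis .
    qed
    \<comment> \<open>\<open>P i * M\<close> is the Hermitian matrix \<open>N i\<close>, so it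
      equals its adjoint \<open>M * P i\<close>.\<close>
    have MP: "M * P i = P i * M" if i: "i < m" for i
    proof -
      have "M * P i = (P i * M)\<^sup>\<dagger>" by (simp add: mat_adjoint_mult Mh)
      thus ?thesis by (simp only: PM[OF i] Nh[OF i])
    qed
    define X where "X = (\<lambda>i. mat_sqrt ((J i)\<^sup>\<dagger> * (M * J i)))"
    have pdJ: "pd_mat (r i) ((J i)\<^sup>\<dagger> * (M * J i))" if i: "i < m" for i
    proof -
      have "\<Psi>\<^sup>\<dagger> * Ki * (K * U) = 1\<^sub>m n"
        using mat_assoc_cong[OF Ki(2), of U] by (simp add: mat_assoc_dim PsiU carrier_matI[of U n n])
      moreover have "K * U \<in> carrier_mat n n" "\<Psi>\<^sup>\<dagger> * Ki \<in> carrier_mat n n" by (auto intro!: carrier_matI)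
      ultimately have "pd_mat (r i) ((J i)\<^sup>\<dagger> * ((K * U)\<^sup>\<dagger> * (K * U) * J i))"
        unfolding J_def using pd_mat_compression[OF dim i] by blast
      thus ?thesis by (simp add: M_def mat_adjoint_mult mat_assoc_dim)
    qed
    have X: "pd_mat (r i) (X i)" if "i < m" for i
      unfolding X_def by (rule pd_mat_sqrt[OF pdJ[OF that]])
    have XX: "X i * X i = (J i)\<^sup>\<dagger> * (M * J i)" if "i < m" for i
      unfolding X_def by (rule mat_sqrt(2)[OF pd_mat_imp_psd_mat[OF pdJ[OF that]]])
    define D where "D = diag_block_mat (map X [0..<m])"
    note Dfacts = diag_block_mat_carrier[OF dim X, folded D_def] diag_block_mat_hermitian[OF dim X, folded D_def]
      diag_block_mat_inverse[OF dim X, folded D_def]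
    have [simp]: "dim_row D = n" "dim_col D = n" "dim_row (mat_inv D) = n" "dim_col (mat_inv D) = n"
      using Dfacts(1,3) by auto
    \<comment> \<open>\<open>M\<close> commutes with every \<open>P i\<close> and is thus determined
      by its diagonal blocks, which are the squares of the blocks \<open>X i\<close> of
      \<open>D\<close>.\<close>
    have "D * D = M"
    proof (rule mat_eq_blockwise[OF dim])
      fix i assume i: "i < m"
      note [simp] = pd_matD(2,3)[OF X[OF i]]
      have DJ: "D * J i = J i * X i"
        unfolding D_def J_def by (rule diag_block_mat_mult_embed[OF dim X i])
      have "D * D * J i = J i * (X i * X i)"
        using mat_assoc_cong[OF DJ, of "X i"] by (simp add: mat_assoc_dim DJ)
      also have "\<dots> = P i * M * J i" unfolding XX[OF i] by (simp add: P_def mat_assoc_dim)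
      also have "\<dots> = M * (J i * ((J i)\<^sup>\<dagger> * J i))"
        unfolding MP[OF i, symmetric] by (simp add: P_def mat_assoc_dim)
      also have "(J i)\<^sup>\<dagger> * J i = 1\<^sub>m (r i)"
        using block_embed_adjoint_mult[OF dim i i] by (simp add: J_def)
      finally show "D * D * block_embed m r i = M * block_embed m r i"
        by (simp add: carrier_matI[of "J i" n "r i"] flip: J_def)
    qed auto
    then obtain S where S: "psd_mat n S" "S * S = D * (\<Psi>\<^sup>\<dagger> * \<Psi>) * D"
      and SPF: "\<And>P F. P \<in> carrier_mat n n \<Longrightarrow> F \<in> carrier_mat n n \<Longrightarrow> P * D = D * P \<Longrightarrow>
        K * F = \<Psi> * P * \<Psi>\<^sup>\<dagger> * F \<Longrightarrow> U\<^sup>\<dagger> * (K * (F * (K * U))) = P * (D * D) \<Longrightarrow>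
        F = (U * (mat_inv D * S)) * P * (U * (mat_inv D * S))\<^sup>\<dagger> \<and> P * (S * P) = D * (D * P)"
      using block_diagonal_of_criterion[of \<Psi> n U D "mat_inv D" Ki K] PsiU Dfacts Ki
        pd_mat_imp_psd_mat[OF pd] unfolding M_def by auto
    have "\<forall>i<m. P i * (S * P i) = D * (D * P i) \<and>
        E i = (U * (mat_inv D * S)) * P i * (U * (mat_inv D * S))\<^sup>\<dagger>"
    proof (intro allI impI)
      fix i assume i: "i < m"
      have "P i * D = D * P i"
        unfolding P_def J_def D_def by (rule diag_block_mat_commute_proj[OF dim X i])
      moreover have "U\<^sup>\<dagger> * (K * (E i * (K * U))) = P i * (D * D)"
        unfolding \<open>D * D = M\<close> PM[OF i] by (simp add: N_def)
      ultimately show "P i * (S * P i) = D * (D * P i) \<and>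
          E i = (U * (mat_inv D * S)) * P i * (U * (mat_inv D * S))\<^sup>\<dagger>"
        using SPF[OF Pc psd_matD(1)[OF E[OF i]] _ KE[OF i]] by blast
    qed
    thus "\<exists>X. (\<forall>i<m. pd_mat (r i) (X i)) \<and>
      (let D = diag_block_mat (map X [0..<m]);
           S = mat_sqrt (D * gram_mat m r \<psi> * D);
           w = (\<lambda>i j. vec_sum n (\<lambda>l. vec_sum n (\<lambda>k.
                 pair_entry r (mat_inv D * S) (l, k) (i, j) \<cdot>\<^sub>v u l k) {..<r l}) {..<m})
       in (\<forall>i<m. diag_block r S i = X i * X i) \<and>
          (\<forall>i<m. E i = mat_sum n (\<lambda>j. ketbra (w i j) (w i j)) {..<r i}))"
      using translate[OF X D_def S] X by blast
  next
    assume "\<exists>X. (\<forall>i<m. pd_mat (r i) (X i)) \<and>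
      (let D = diag_block_mat (map X [0..<m]);
           S = mat_sqrt (D * gram_mat m r \<psi> * D);
           w = (\<lambda>i j. vec_sum n (\<lambda>l. vec_sum n (\<lambda>k.
                 pair_entry r (mat_inv D * S) (l, k) (i, j) \<cdot>\<^sub>v u l k) {..<r l}) {..<m})
       in (\<forall>i<m. diag_block r S i = X i * X i) \<and>
          (\<forall>i<m. E i = mat_sum n (\<lambda>j. ketbra (w i j) (w i j)) {..<r i}))"
    then obtain X where X: "\<And>i. i < m \<Longrightarrow> pd_mat (r i) (X i)" and *: "(let D = diag_block_mat (map X [0..<m]);
           S = mat_sqrt (D * gram_mat m r \<psi> * D);
           w = (\<lambda>i j. vec_sum n (\<lambda>l. vec_sum n (\<lambda>k.
                 pair_entry r (mat_inv D * S) (l, k) (i, j) \<cdot>\<^sub>v u l k) {..<r l}) {..<m})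
       in (\<forall>i<m. diag_block r S i = X i * X i) \<and>
          (\<forall>i<m. E i = mat_sum n (\<lambda>j. ketbra (w i j) (w i j)) {..<r i}))"
      by blast
    define D where "D = diag_block_mat (map X [0..<m])"
    note Dfacts = diag_block_mat_carrier[OF dim X, folded D_def] diag_block_mat_hermitian[OF dim X, folded D_def]
      diag_block_mat_inverse[OF dim X, folded D_def]
    have [simp]: "dim_row D = n" "dim_col D = n" "dim_row (mat_inv D) = n" "dim_col (mat_inv D) = n"
      using Dfacts(1,3) by auto
    \<comment> \<open>\<open>D G D\<close> is a matrix times its own adjoint, so a positive root
      exists.\<close>
    have "psd_mat n ((\<Psi> * D)\<^sup>\<dagger> * (\<Psi> * D))"
      by (rule psd_mat_adjoint_mult_self) (auto intro!: carrier_matI)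
    hence "psd_mat n (D * (\<Psi>\<^sup>\<dagger> * \<Psi>) * D)" by (simp add: mat_adjoint_mult mat_assoc_dim Dfacts(2))
    then obtain S where S: "psd_mat n S" "S * S = D * (\<Psi>\<^sup>\<dagger> * \<Psi>) * D" using psd_mat_sqrt_ex by blast
    have iff: "\<forall>i<m. P i * (S * P i) = D * (D * P i) \<and>
        E i = (U * (mat_inv D * S)) * P i * (U * (mat_inv D * S))\<^sup>\<dagger>"
      using translate[OF X D_def S] * by blast
    define K where "K = \<Psi> * D * (U * (mat_inv D * S))\<^sup>\<dagger>"
    note crit = criterion_of_block_diagonal[of \<Psi> n U D "mat_inv D" S, folded K_def, OF _ _ _ _ _ _ _ _ PsiU
        Dfacts(2,4,5) S]
    have "psd_mat n (K - \<Psi> * P i * \<Psi>\<^sup>\<dagger>) \<and> K * E i = \<Psi> * P i * \<Psi>\<^sup>\<dagger> * E i" if i: "i < m" for i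
    proof -
      have "P i * D = D * P i"
        unfolding P_def J_def D_def by (rule diag_block_mat_commute_proj[OF dim X i])
      thus ?thesis using crit(2)[of "P i"] iff i by simp
    qed
    moreover have "K \<in> carrier_mat n n" using crit(1) by simp
    ultimately show "med_optimal n m p \<rho> E" unfolding opt by blast
  qed
qed

end
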